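(* Let $I=[a,b]$ be a bounded interval with $a<b$. There exists a constant $C_3$ with $0<C_3<b-a$ such that for every $f\in W^{3,\infty}(I)$ and every partition $X=\{a=x_0<x_1<\dots<x_n=b\}$ of $I$, with $h=\max_{1\le i\le n}(x_i-x_{i-1})$, $$|E_Q(f,I)|\le C_3\,h^3\,\|D^3f\|_{\infty},$$ where $E_Q(f,I)=\int_a^b f-\int_a^b Qf$ and $Q$ is the discrete quadratic spline quasi-interpolant associated with $X$.
   Context: Let $X=\{a=x_0<x_1<\dots<x_n=b\}$ be a partition of $I=[a,b]$, $h_i=x_i-x_{i-1}$ for $1\le i\le n$. Extend the knots by $x_{-2}=x_{-1}=a$ and $x_{n+1}=x_{n+2}=b$ (so $h_0=h_{n+1}=0$). Let $B_0,\dots,B_{n+1}$ be the quadratic B-splines on these knots, with $B_i$ supported on $[x_{i-2},x_{i+1}]$, normalized so that $\sum_{i=0}^{n+1}B_i=1$ on $I$; they form a basis of the space of $C^1$ quadratic splines on $X$. Set $\theta_i=\frac12(x_{i-1}+x_i)$ for $0\le i\le n+1$ (so $\theta_0=a$, $\theta_{n+1}=b$), and $\sigma_i=\frac{h_i}{h_{i-1}+h_i}$, $\sigma_i'=1-\sigma_i=\frac{h_{i-1}}{h_{i-1}+h_i}$ for $1\le i\le n+1$. For $1\le i\le n$ put $$a_i=-\frac{\sigma_i^2\sigma'_{i+1}}{\sigma_i+\sigma'_{i+1}},\quad b_i=1+\sigma_i\sigma'_{i+1},\quad c_i=-\frac{\sigma_i(\sigma'_{i+1})^2}{\sigma_i+\sigma'_{i+1}}.$$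 The quasi-interpolant is $Qf=\sum_{i=0}^{n+1}\mu_i(f)B_i$, with $\mu_0(f)=f(x_0)$, $\mu_{n+1}(f)=f(x_n)$ and $\mu_i(f)=a_if(\theta_{i-1})+b_if(\theta_i)+c_if(\theta_{i+1})$ for $1\le i\le n$. $W^{3,\infty}(I)$ is the usual Sobolev space (its elements being identified with their continuous representatives), $D^3f$ is the third (weak) derivative, and $\|\cdot\|_\infty$ is the (essential) supremum norm on $I$. *)

theory Defs
  imports "HOL-Analysis.Analysis" "HOL-Probability.Essential_Supremum"
begin

section \<open>Sobolev spaces of essentially bounded functions on an interval\<close>

definition test_fun :: "real \<Rightarrow> real \<Rightarrow> (real \<Rightarrow> real) \<Rightarrow> bool" where
  "test_fun a b \<phi> \<longleftrightarrow>
     (\<forall>k x. (deriv ^^ k) \<phi> differentiable (at x)) \<and>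
     (\<exists>K. compact K \<and> K \<subseteq> {a<..<b} \<and> (\<forall>x. x \<notin> K \<longrightarrow> \<phi> x = 0))"

definition locally_integrable :: "real \<Rightarrow> real \<Rightarrow> (real \<Rightarrow> real) \<Rightarrow> bool" where
  "locally_integrable a b f \<longleftrightarrow>
     (\<forall>K. compact K \<and> K \<subseteq> {a<..<b} \<longrightarrow> set_integrable lebesgue K f)"

definition has_weak_deriv ::
  "real \<Rightarrow> real \<Rightarrow> nat \<Rightarrow> (real \<Rightarrow> real) \<Rightarrow> (real \<Rightarrow> real) \<Rightarrow> bool" where
  "has_weak_deriv a b k f g \<longleftrightarrow>
     locally_integrable a b f \<and> locally_integrable a b g \<and>
     (\<forall>\<phi>. test_fun a b \<phi> \<longrightarrow>
        (LINT x:{a<..<b}|lebesgue. f x * (deriv ^^ k) \<phi> x) =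
        (-1) ^ k * (LINT x:{a<..<b}|lebesgue. g x * \<phi> x))"

text \<open>Weak derivatives are unique only up to null sets in the interval; the choice of a version
  does not affect the norm \<open>Linf_norm\<close> below.\<close>

definition weak_deriv :: "real \<Rightarrow> real \<Rightarrow> nat \<Rightarrow> (real \<Rightarrow> real) \<Rightarrow> real \<Rightarrow> real" where
  "weak_deriv a b k f = (SOME g. has_weak_deriv a b k f g)"

definition Linf :: "real \<Rightarrow> real \<Rightarrow> (real \<Rightarrow> real) set" where
  "Linf a b = {f \<in> borel_measurable (lebesgue_on {a<..<b}).
     esssup (lebesgue_on {a<..<b}) (\<lambda>x. ereal \<bar>f x\<bar>) < \<infinity>}"

definition Linf_norm :: "real \<Rightarrow> real \<Rightarrow> (real \<Rightarrow> real) \<Rightarrow> real" where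
  "Linf_norm a b f = real_of_ereal (esssup (lebesgue_on {a<..<b}) (\<lambda>x. ereal \<bar>f x\<bar>))"

text \<open>\<open>sobolev_inf k a b\<close> is \<open>W\<^sup>k\<^sup>,\<^sup>\<infinity>(a, b)\<close>, as a set of functions rather than of
  almost-everywhere classes. Passing to the continuous representative is a separate
  continuity requirement on the closed interval.\<close>

definition sobolev_inf :: "nat \<Rightarrow> real \<Rightarrow> real \<Rightarrow> (real \<Rightarrow> real) set" where
  "sobolev_inf k a b =
     {f \<in> Linf a b. \<forall>j\<in>{1..k}. \<exists>g\<in>Linf a b. has_weak_deriv a b j f g}"


section \<open>Partitions and quadratic B-splines\<close>

definition is_partition :: "real \<Rightarrow> real \<Rightarrow> nat \<Rightarrow> (nat \<Rightarrow> real) \<Rightarrow> bool" where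
  "is_partition a b n x \<longleftrightarrow> x 0 = a \<and> x n = b \<and> strict_mono_on {0..n} x"

definition mesh :: "nat \<Rightarrow> (nat \<Rightarrow> real) \<Rightarrow> real" where
  "mesh n x = Max ((\<lambda>i. x i - x (i - 1)) ` {1..n})"

text \<open>Extended knots: \<open>x\<^sub>0\<close> for negative indices and \<open>x\<^sub>n\<close> for indices above \<open>n\<close>.\<close>

definition knot :: "nat \<Rightarrow> (nat \<Rightarrow> real) \<Rightarrow> int \<Rightarrow> real" where
  "knot n x i = x (nat (max 0 (min i (int n))))"

text \<open>Cox--de Boor recursion for the normalized B-spline of degree \<open>k\<close> on the knots
  \<open>t\<^sub>j, \<dots>, t\<^bsub>j+k+1\<^esub>\<close>. The convention that terms with a vanishing denominator
  are dropped is \<open>y / 0 = 0\<close>. Knot intervals are half-open, except that the last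
  nondegenerate one also contains its right end point \<open>e\<close>, so that
  the B-splines sum to 1 there too.\<close>

fun bspline :: "(int \<Rightarrow> real) \<Rightarrow> real \<Rightarrow> nat \<Rightarrow> int \<Rightarrow> real \<Rightarrow> real" where
  "bspline t e 0 j u =
     (if t j \<le> u \<and> u < t (j + 1) \<or> t j < t (j + 1) \<and> u = t (j + 1) \<and> u = e then 1 else 0)"
| "bspline t e (Suc k) j u =
     (u - t j) / (t (j + int k + 1) - t j) * bspline t e k j u +
     (t (j + int k + 2) - u) / (t (j + int k + 2) - t (j + 1)) * bspline t e k (j + 1) u"

text \<open>The index is shifted so that \<open>B\<^sub>i\<close> is supported on \<open>[x\<^bsub>i-2\<^esub>, x\<^bsub>i+1\<^esub>]\<close>.\<close>

definition qB :: "nat \<Rightarrow> (nat \<Rightarrow> real) \<Rightarrow> int \<Rightarrow> real \<Rightarrow> real" where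
  "qB n x i u = bspline (knot n x) (x n) 2 (i - 2) u"


section \<open>The discrete quasi-interpolant\<close>

definition step :: "nat \<Rightarrow> (nat \<Rightarrow> real) \<Rightarrow> int \<Rightarrow> real" where
  "step n x i = knot n x i - knot n x (i - 1)"

definition theta :: "nat \<Rightarrow> (nat \<Rightarrow> real) \<Rightarrow> int \<Rightarrow> real" where
  "theta n x i = (knot n x (i - 1) + knot n x i) / 2"

definition sigma :: "nat \<Rightarrow> (nat \<Rightarrow> real) \<Rightarrow> int \<Rightarrow> real" where
  "sigma n x i = step n x i / (step n x (i - 1) + step n x i)"

definition sigma' :: "nat \<Rightarrow> (nat \<Rightarrow> real) \<Rightarrow> int \<Rightarrow> real" where
  "sigma' n x i = 1 - sigma n x i"

definition coef_a :: "nat \<Rightarrow> (nat \<Rightarrow> real) \<Rightarrow> int \<Rightarrow> real" where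
  "coef_a n x i =
     - ((sigma n x i)\<^sup>2 * sigma' n x (i + 1) / (sigma n x i + sigma' n x (i + 1)))"

definition coef_b :: "nat \<Rightarrow> (nat \<Rightarrow> real) \<Rightarrow> int \<Rightarrow> real" where
  "coef_b n x i = 1 + sigma n x i * sigma' n x (i + 1)"

definition coef_c :: "nat \<Rightarrow> (nat \<Rightarrow> real) \<Rightarrow> int \<Rightarrow> real" where
  "coef_c n x i =
     - (sigma n x i * (sigma' n x (i + 1))\<^sup>2 / (sigma n x i + sigma' n x (i + 1)))"

definition mu :: "nat \<Rightarrow> (nat \<Rightarrow> real) \<Rightarrow> int \<Rightarrow> (real \<Rightarrow> real) \<Rightarrow> real" where
  "mu n x i f =
     (if i = 0 then f (x 0)
      else if i = int n + 1 then f (x n)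
      else coef_a n x i * f (theta n x (i - 1)) + coef_b n x i * f (theta n x i)
         + coef_c n x i * f (theta n x (i + 1)))"

definition quasi_interp :: "nat \<Rightarrow> (nat \<Rightarrow> real) \<Rightarrow> (real \<Rightarrow> real) \<Rightarrow> real \<Rightarrow> real" where
  "quasi_interp n x f u = (\<Sum>i\<in>{0..int n + 1}. mu n x i f * qB n x i u)"

definition quad_error ::
  "real \<Rightarrow> real \<Rightarrow> nat \<Rightarrow> (nat \<Rightarrow> real) \<Rightarrow> (real \<Rightarrow> real) \<Rightarrow> real" where
  "quad_error a b n x f = integral {a..b} f - integral {a..b} (quasi_interp n x f)"

end

theory Submission
  imports Defs
begin

text \<open>
  The constant is \<open>5 / 6 (b - a)\<close>, and it comes from a pointwise estimate: for every \<open>u\<close> in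
  \<open>[a, b]\<close>, \<open>\<bar>f(u) - Q f(u)\<bar>\<close> is at most \<open>5 / 6 h\<^sup>3\<close> times the norm of the third derivative
  (\<open>quasi_interp_error\<close>). Integrating it over \<open>[a, b]\<close> gives the claim.

  For a smooth function the pointwise estimate is local. On one knot interval only three B-splines
  are active, and \<open>Q\<close> reproduces quadratic polynomials there (\<open>quasi_interp_quadratic\<close>): each functional
  \<open>\<mu>\<^sub>i\<close> returns the blossom of a quadratic at two consecutive knots, and de Boor's algorithm
  then evaluates that blossom on the diagonal. Subtracting the Taylor polynomial at
  the midpoint \<open>\<theta>\<^sub>j\<close> of the interval leaves a function bounded by a multiple of
  \<open>\<bar>t - \<theta>\<^sub>j\<bar>\<^sup>3\<close>. A crude bound of \<open>Q\<close> by its norm would give too large a constant; what saves the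
  estimate is that the outer functionals are only large where the corresponding B-splines are
  small (\<open>quasi_interp_cubic_bound\<close>).

  To pass to Sobolev functions, note that the error at \<open>u\<close> involves only finitely many point values, so
  it suffices to approximate \<open>f\<close> pointwise on the closed interval by smooth functions with the same
  bound on the third derivative (\<open>smooth_approximation\<close>). Convolution with a smooth bump does
  this, because the defining identity of the weak derivative, applied to the translated bump,
  expresses the third derivative of the convolution as an average of the weak derivative. Since the weak
  derivative is selected by choice, its norm has meaning only through its uniqueness almost
  everywhere (\<open>weak_deriv_unique\<close>), which follows by testing against bumps that converge to
  indicators of intervals.
\<close>

section \<open>Smooth bump functions\<close>

text \<open>The functions \<open>p(1/x) exp(-1/x)\<close>, extended by \<open>0\<close> to \<open>x \<le> 0\<close>. A single flat function
  \<open>exp(-1/x)\<close> would be enough to define bumps; carrying a polynomial factor makes the class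
  closed under differentiation, so that smoothness needs no separate induction on the order.\<close>

definition flat :: "real poly \<Rightarrow> real \<Rightarrow> real" where
  "flat p x = (if x > 0 then poly p (1 / x) * exp (- (1 / x)) else 0)"

lemma poly_times_exp_neg_tendsto_0:
  fixes p :: "real poly"
  shows "((\<lambda>y. poly p y * exp (- y)) \<longlongrightarrow> 0) at_top"
proof -
  have "((\<lambda>y::real. \<Sum>i\<le>degree p. coeff p i * (y ^ i / exp y)) \<longlongrightarrow> (\<Sum>i\<le>degree p. coeff p i * 0)) at_top"
    by (intro tendsto_intros tendsto_power_div_exp_0)
  then show ?thesis
    by (simp add: poly_altdef exp_minus field_simps sum_divide_distrib)
qed

text \<open>Away from \<open>0\<close> this is the chain rule. At \<open>0\<close> the difference quotient from the right is again of
  the form \<open>q(1/x) exp(-1/x)\<close>, with \<open>q = X p\<close>, and vanishes in the limit because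
  \<open>exp\<close> beats every polynomial.\<close>

lemma flat_has_deriv:
  "(flat p has_real_derivative flat ([:0, 0, 1:] * (p - pderiv p)) x) (at x)"
proof (cases x "0 :: real" rule: linorder_cases)
  case less
  have "((\<lambda>_. 0) has_real_derivative 0) (at x)" by simp
  moreover have "\<forall>\<^sub>F y in nhds x. flat p y = 0"
    using eventually_nhds_in_open[of "{..<0}" x] less
    by (auto simp: flat_def elim!: eventually_mono)
  ultimately show ?thesis
    using less by (subst DERIV_cong_ev[OF refl _ refl, of _ "\<lambda>_. 0"]) (auto simp: flat_def)
next
  case greater
  have "((\<lambda>y. poly p (1 / y) * exp (- (1 / y))) has_real_derivative
      flat ([:0, 0, 1:] * (p - pderiv p)) x) (at x)"
    using greater
    by (auto intro!: derivative_eq_intros DERIV_chain2[OF poly_DERIV] simp: flat_def power2_eq_square field_simps)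
  moreover have "\<forall>\<^sub>F y in nhds x. flat p y = poly p (1 / y) * exp (- (1 / y))"
    using eventually_nhds_in_open[of "{0<..}" x] greater
    by (auto simp: flat_def elim!: eventually_mono)
  ultimately show ?thesis
    by (subst DERIV_cong_ev[OF refl _ refl])
next
  case equal
  have "((\<lambda>y. poly (pCons 0 p) (inverse y) * exp (- (inverse y))) \<longlongrightarrow> 0) (at_right (0::real))"
    by (rule filterlim_compose[OF poly_times_exp_neg_tendsto_0 filterlim_inverse_at_top_right])
  then have R: "((\<lambda>y. flat p y / y) \<longlongrightarrow> 0) (at_right 0)"
    by (rule Lim_transform_eventually)
       (auto simp: eventually_at_filter flat_def field_simps)
  have L: "((\<lambda>y. flat p y / y) \<longlongrightarrow> 0) (at_left 0)"
    by (rule Lim_transform_eventually[OF tendsto_const])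
       (auto simp: eventually_at_filter flat_def)
  from filterlim_split_at[OF L R] show ?thesis
    by (simp add: equal has_field_derivative_iff flat_def)
qed

text \<open>Derivatives of a bump are sums of products of flat functions centred at the two end points;
  closing the products under addition gives a class that contains all of them. The scale \<open>r\<close> is
  there for the limit \<open>r \<rightarrow> \<infinity>\<close>, in which the bump becomes an indicator.\<close>

inductive_set flat_products :: "real \<Rightarrow> real \<Rightarrow> real \<Rightarrow> (real \<Rightarrow> real) set" for r c d where
  prod: "(\<lambda>x. flat p (r * (x - c)) * flat q (r * (d - x))) \<in> flat_products r c d"
| add: "\<phi> \<in> flat_products r c d \<Longrightarrow> \<psi> \<in> flat_products r c d \<Longrightarrow>
    (\<lambda>x. \<phi> x + \<psi> x) \<in> flat_products r c d"

lemma smult_flat: "flat (smult k p) x = k * flat p x"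
  by (simp add: flat_def)

lemma flat_products_deriv:
  assumes "\<phi> \<in> flat_products r c d"
  shows "\<exists>\<psi>\<in>flat_products r c d. \<forall>x. (\<phi> has_real_derivative \<psi> x) (at x)"
  using assms
proof induction
  case (prod p q)
  let ?D = "\<lambda>p. [:0, 0, 1:] * (p - pderiv p)"
  let ?\<psi> = "\<lambda>x. flat (smult r (?D p)) (r * (x - c)) * flat q (r * (d - x))
            + flat (smult (- r) p) (r * (x - c)) * flat (?D q) (r * (d - x))"
  have mem: "?\<psi> \<in> flat_products r c d"
    by (intro flat_products.intros)
  have der: "((\<lambda>x. flat p (r * (x - c)) * flat q (r * (d - x))) has_real_derivative ?\<psi> x) (at x)" for x
  proof -
    have "((\<lambda>x. r * (x - c)) has_real_derivative r) (at x)"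
         "((\<lambda>x. r * (d - x)) has_real_derivative - r) (at x)"
      by (auto intro!: derivative_eq_intros)
    note this[THEN DERIV_chain2[OF flat_has_deriv]]
    from DERIV_mult[OF this] show ?thesis
      by (simp only: smult_flat) (simp only: ac_simps mult_minus_left mult_minus_right)
  qed
  show ?case
    by (rule bexI[OF _ mem]) (rule allI, rule der)
next
  case (add \<phi> \<psi>)
  then obtain \<phi>' \<psi>' where "\<phi>' \<in> flat_products r c d" "\<psi>' \<in> flat_products r c d"
    and "\<And>x. (\<phi> has_real_derivative \<phi>' x) (at x)" "\<And>x. (\<psi> has_real_derivative \<psi>' x) (at x)"
    by blast
  then show ?case
    by (intro bexI[of _ "\<lambda>x. \<phi>' x + \<psi>' x"] allI DERIV_add flat_products.add)
qed

lemma flat_products_higher_deriv: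
  assumes "\<phi> \<in> flat_products r c d"
  shows "(deriv ^^ k) \<phi> \<in> flat_products r c d"
proof (induction k)
  case (Suc k)
  then obtain \<psi> where "\<psi> \<in> flat_products r c d" "\<And>x. ((deriv ^^ k) \<phi> has_real_derivative \<psi> x) (at x)"
    using flat_products_deriv by blast
  moreover from this have "deriv ((deriv ^^ k) \<phi>) = \<psi>"
    by (auto intro: DERIV_imp_deriv)
  ultimately show ?case by simp
qed (use assms in simp)

lemma flat_products_higher_deriv_DERIV:
  assumes "\<phi> \<in> flat_products r c d"
  shows "((deriv ^^ k) \<phi> has_real_derivative (deriv ^^ Suc k) \<phi> x) (at x)"
  using flat_products_deriv[OF flat_products_higher_deriv[OF assms, of k]]
  by (auto dest!: spec[of _ x] simp: DERIV_imp_deriv)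

definition bump :: "real \<Rightarrow> real \<Rightarrow> real \<Rightarrow> real \<Rightarrow> real" where
  "bump r c d x = flat 1 (r * (x - c)) * flat 1 (r * (d - x))"

lemma bump_higher_deriv_DERIV:
  "((deriv ^^ k) (bump r c d) has_real_derivative (deriv ^^ Suc k) (bump r c d) x) (at x)"
  unfolding bump_def [abs_def]
  by (rule flat_products_higher_deriv_DERIV) (rule flat_products.prod)

lemma bump_higher_deriv_continuous: "continuous_on A ((deriv ^^ k) (bump r c d))"
  by (meson DERIV_isCont bump_higher_deriv_DERIV continuous_at_imp_continuous_on)

lemma bump_continuous: "continuous_on A (bump r c d)"
  using bump_higher_deriv_continuous[of A 0] by simp

lemma bump_nonneg: "0 \<le> bump r c d x"
  by (simp add: bump_def flat_def)

lemma bump_le_1: "r > 0 \<Longrightarrow> bump r c d x \<le> 1"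
  by (auto simp: bump_def flat_def mult_le_one)

lemma bump_outside: "r > 0 \<Longrightarrow> x \<notin> {c<..<d} \<Longrightarrow> bump r c d x = 0"
  by (auto simp: bump_def flat_def zero_less_mult_iff)

lemma bump_pos: "r > 0 \<Longrightarrow> x \<in> {c<..<d} \<Longrightarrow> 0 < bump r c d x"
  by (auto simp: bump_def flat_def zero_less_mult_iff)

lemma bump_test_fun:
  assumes "r > 0" "a < c" "d < b"
  shows "test_fun a b (bump r c d)"
  unfolding test_fun_def
proof (intro conjI allI exI[of _ "{c..d}"])
  show "(deriv ^^ k) (bump r c d) differentiable at x" for k x
    unfolding real_differentiable_def by (intro exI) (rule bump_higher_deriv_DERIV)
qed (use assms bump_outside[of r _ c d] in auto)

text \<open>On \<open>(c, d)\<close> the bump is \<open>exp(-1/(r (x - c)) - 1/(r (d - x)))\<close>, so increasing the scale \<open>r\<close>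
  pushes it up to \<open>1\<close> while the support stays fixed. These are test functions that converge
  boundedly to the indicator of an interval, without any smoothing of indicators.\<close>

lemma bump_tendsto_indicator:
  "(\<lambda>n. bump (real (Suc n)) c d x) \<longlonglongrightarrow> indicator {c<..<d} x"
proof (cases "x \<in> {c<..<d}")
  case True
  have "(\<lambda>n. exp (- (inverse (real (Suc n)) / (x - c))) * exp (- (inverse (real (Suc n)) / (d - x)))) \<longlonglongrightarrow>
        exp (- (0 / (x - c))) * exp (- (0 / (d - x)))"
    using True by (intro tendsto_intros LIMSEQ_inverse_real_of_nat) auto
  then show ?thesis
    using True by (simp add: bump_def flat_def zero_less_mult_iff field_simps del: of_nat_Suc)
next
  case False
  then show ?thesis using bump_outside by simp
qed

lemma bump_shift: "bump r (c + s) (d + s) x = bump r c d (x - s)"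
  by (simp add: bump_def algebra_simps)

lemma bump_higher_deriv_shift:
  "(deriv ^^ k) (bump r (c + s) (d + s)) = (\<lambda>x. (deriv ^^ k) (bump r c d) (x - s))"
proof (induction k)
  case 0
  show ?case by (auto simp: bump_shift)
next
  case (Suc k)
  have "deriv (\<lambda>x. (deriv ^^ k) (bump r c d) (x - s)) x = (deriv ^^ Suc k) (bump r c d) (x - s)" for x
    using bump_higher_deriv_DERIV[of k r c d "x + - s"]
    by (intro DERIV_imp_deriv) (simp only: DERIV_shift diff_conv_add_uminus)
  with Suc show ?case by simp
qed

section \<open>Uniqueness of weak derivatives\<close>

lemma sigma_finite_lebesgue: "sigma_finite_measure (lebesgue :: real measure)"
proof
  obtain A :: "real set set" where "countable A" "A \<subseteq> sets lborel" "\<Union>A = space lborel"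
    "\<forall>a\<in>A. emeasure lborel a \<noteq> \<infinity>"
    using lborel.sigma_finite_countable by blast
  then show "\<exists>A::real set set. countable A \<and> A \<subseteq> sets lebesgue \<and> \<Union>A = space lebesgue \<and>
      (\<forall>a\<in>A. emeasure lebesgue a \<noteq> \<infinity>)"
    by (intro exI[of _ A]) auto
qed

text \<open>The open intervals generate the Borel sets and are closed under intersection, so the sets over
  which \<open>H\<close> integrates to zero, which form a Dynkin system, contain all Borel sets, and
  then all Lebesgue sets since these differ from Borel sets by null sets.\<close>

lemma AE_zero_if_interval_integrals_zero:
  fixes H :: "real \<Rightarrow> real"
  assumes int: "integrable lebesgue H"
    and zero: "\<And>c d. (LINT x:{c<..<d}|lebesgue. H x) = 0"
  shows "AE x in lebesgue. H x = 0"
proof (rule sigma_finite_measure.density_zero[OF sigma_finite_lebesgue int])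
  have si: "set_integrable lebesgue A H" if "A \<in> sets lebesgue" for A
    using integrable_mult_indicator[OF that int] by (simp add: set_integrable_def)
  have all: "(LINT x|lebesgue. H x) = 0"
  proof (rule LIMSEQ_unique)
    show "(\<lambda>n. LINT x|lebesgue. indicator {-real n<..<real n} x * H x) \<longlonglongrightarrow> (LINT x|lebesgue. H x)"
    proof (rule integral_dominated_convergence[where w = "\<lambda>x. \<bar>H x\<bar>"])
      show "AE x in lebesgue. (\<lambda>n. indicator {- real n<..<real n} x * H x) \<longlonglongrightarrow> H x"
      proof (rule AE_I2)
        fix x :: real
        obtain N where "\<bar>x\<bar> < real N" using reals_Archimedean2 by blast
        then have "\<forall>\<^sub>F n in sequentially. indicator {- real n<..<real n} x * H x = H x"
          by (intro eventually_sequentiallyI[of N]) (auto split: split_indicator)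
        then show "(\<lambda>n. indicator {- real n<..<real n} x * H x) \<longlonglongrightarrow> H x"
          by (rule tendsto_eventually)
      qed
      show "(\<lambda>x. indicator {- real n<..<real n} x * H x) \<in> borel_measurable lebesgue" for n
        by (intro borel_measurable_times borel_measurable_indicator borel_measurable_integrable int) auto
    qed (use int in \<open>auto split: split_indicator\<close>)
    show "(\<lambda>n. LINT x|lebesgue. indicator {-real n<..<real n} x * H x) \<longlonglongrightarrow> 0"
      using zero by (simp add: set_lebesgue_integral_def)
  qed
  have sets_borel: "sets borel = sigma_sets UNIV (range (\<lambda>(c, d). {c<..<d :: real}))"
    by (simp add: borel_eq_box box_real)
  have borel: "(LINT x:A|lebesgue. H x) = 0" if "A \<in> sets borel" for A
  proof -
    have "Int_stable (range (\<lambda>(c, d). {c<..<d :: real}))"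
      by (auto simp: Int_stable_def)
    moreover have "range (\<lambda>(c, d). {c<..<d :: real}) \<subseteq> Pow UNIV"
      by auto
    moreover have "A \<in> sigma_sets UNIV (range (\<lambda>(c, d). {c<..<d :: real}))"
      using that by (simp only: sets_borel)
    ultimately show ?thesis
    proof (induction rule: sigma_sets_induct_disjoint)
      case (compl A)
      then have A: "A \<in> sets lebesgue"
        by (simp only: sets_borel[symmetric]) simp
      have "(LINT x:UNIV - A|lebesgue. H x) = (LINT x|lebesgue. H x - indicator A x *\<^sub>R H x)"
        unfolding set_lebesgue_integral_def
        by (intro Bochner_Integration.integral_cong) (auto split: split_indicator)
      also have "\<dots> = (LINT x|lebesgue. H x) - (LINT x:A|lebesgue. H x)"
        using si[OF A] int unfolding set_lebesgue_integral_def set_integrable_def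
        by (intro Bochner_Integration.integral_diff)
      finally have "(LINT x:UNIV - A|lebesgue. H x) = (LINT x|lebesgue. H x) - (LINT x:A|lebesgue. H x)" .
      with compl all show ?case by simp
    next
      case (union F)
      have F: "F i \<in> sets lebesgue" for i
        using union(2) by (simp only: sets_borel[symmetric]) auto
      have "(LINT x:(\<Union>i. F i)|lebesgue. H x) = (\<Sum>i. (LINT x:F i|lebesgue. H x))"
        using union F si by (intro lebesgue_integral_countable_add) (auto simp: disjoint_family_on_def)
      with union show ?case by simp
    qed (use zero in \<open>auto simp: set_lebesgue_integral_def\<close>)
  qed
  fix A :: "real set"
  assume "A \<in> sets lebesgue"
  then obtain S N N' where A: "A = S \<union> N" "N \<subseteq> N'" "N' \<in> null_sets lborel" "S \<in> sets lborel"
    by (rule sets_completionE)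
  have "AE x in lebesgue. x \<notin> N'"
    using A(3) by (intro AE_not_in) (auto simp: null_sets_completionI)
  then have "(LINT x:A|lebesgue. H x) = (LINT x:S|lebesgue. H x)"
    unfolding set_lebesgue_integral_def
    using A \<open>A \<in> sets lebesgue\<close> si[OF \<open>A \<in> sets lebesgue\<close>] si[of S]
    by (intro integral_cong_AE) (auto simp: set_integrable_def split: split_indicator elim!: eventually_mono)
  with borel[of S] A show "(LINT x:A|lebesgue. H x) = 0" by simp
qed

lemma locally_integrable_Icc:
  assumes "locally_integrable a b h" "a < c" "d < b"
  shows "set_integrable lebesgue {c..d} h"
proof -
  have "{c..d} \<subseteq> {a<..<b}" using assms by auto
  with assms show ?thesis unfolding locally_integrable_def by blast
qed

lemma locally_integrable_measurable:
  assumes "locally_integrable a b h"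
  shows "h \<in> borel_measurable (lebesgue_on {a<..<b})"
proof -
  have "(\<lambda>x. indicator {a<..<b} x * h x) \<in> borel_measurable lebesgue"
  proof (rule borel_measurable_LIMSEQ_real)
    fix n
    have "set_integrable lebesgue {a + inverse (real (Suc n))..b - inverse (real (Suc n))} h"
      by (rule locally_integrable_Icc[OF assms]) (simp_all del: of_nat_Suc)
    then show "(\<lambda>x. indicator {a + inverse (real (Suc n))..b - inverse (real (Suc n))} x * h x) \<in> borel_measurable lebesgue"
      by (simp add: set_integrable_def borel_measurable_integrable)
  next
    fix x
    have "\<forall>\<^sub>F n in sequentially. indicator {a + inverse (real (Suc n))..b - inverse (real (Suc n))} x * h x
       = indicator {a<..<b} x * h x"
    proof (cases "x \<in> {a<..<b}")
      case True
      then have "\<forall>\<^sub>F n in sequentially. inverse (real (Suc n)) < min (x - a) (b - x)"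
        by (intro order_tendstoD(2)[OF LIMSEQ_inverse_real_of_nat]) auto
      then show ?thesis using True
        by (elim eventually_mono) (auto simp del: of_nat_Suc)
    next
      case False
      then have "x \<notin> {a + inverse (real (Suc n))..b - inverse (real (Suc n))}" for n
        using inverse_positive_iff_positive[of "real (Suc n)"] by (auto simp del: of_nat_Suc inverse_positive_iff_positive)
      then show ?thesis using False by (simp del: of_nat_Suc atLeastAtMost_iff)
    qed
    then show "(\<lambda>n. indicator {a + inverse (real (Suc n))..b - inverse (real (Suc n))} x * h x)
        \<longlonglongrightarrow> indicator {a<..<b} x * h x"
      by (rule tendsto_eventually)
  qed
  then show ?thesis
    by (subst borel_measurable_restrict_space_iff) (auto simp: mult.commute)
qed

text \<open>The fundamental lemma of the calculus of variations. Testing against bumps of growing scale and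
  passing to the limit by dominated convergence shows that \<open>h\<close> integrates to zero over every
  interval compactly contained in \<open>(a, b)\<close>; exhausting \<open>(a, b)\<close> by such intervals is
  forced by \<open>h\<close> being only locally integrable.\<close>

lemma AE_zero_if_test_integrals_zero:
  assumes loc: "locally_integrable a b h"
    and zero: "\<And>\<phi>. test_fun a b \<phi> \<Longrightarrow> (LINT x:{a<..<b}|lebesgue. h x * \<phi> x) = 0"
  shows "AE x in lebesgue. x \<in> {a<..<b} \<longrightarrow> h x = 0"
proof -
  have interval: "(LINT x:{c<..<d}|lebesgue. h x) = 0" if cd: "a < c" "d < b" for c d
  proof -
    have hi: "integrable lebesgue (\<lambda>x. indicator {c..d} x * h x)"
      using locally_integrable_Icc[OF loc cd] by (simp add: set_integrable_def)
    have eq: "(LINT x|lebesgue. indicator {c..d} x * h x * bump (real (Suc n)) c d x) = 0" for n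
    proof -
      have "(LINT x|lebesgue. indicator {c..d} x * h x * bump (real (Suc n)) c d x)
          = (LINT x:{a<..<b}|lebesgue. h x * bump (real (Suc n)) c d x)"
        unfolding set_lebesgue_integral_def
        using bump_outside[of "real (Suc n)" _ c d] cd
        by (intro Bochner_Integration.integral_cong refl) (auto split: split_indicator simp del: of_nat_Suc)
      then show ?thesis using zero[OF bump_test_fun] cd by (simp del: of_nat_Suc)
    qed
    have "(\<lambda>n. LINT x|lebesgue. indicator {c..d} x * h x * bump (real (Suc n)) c d x) \<longlonglongrightarrow>
        (LINT x|lebesgue. indicator {c..d} x * h x * indicator {c<..<d} x)"
    proof (rule integral_dominated_convergence[where w = "\<lambda>x. \<bar>indicator {c..d} x * h x\<bar>"])
      show meas: "(\<lambda>x. indicator {c..d} x * h x * bump (real (Suc n)) c d x) \<in> borel_measurable lebesgue" for n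
        using bump_continuous[of UNIV "real (Suc n)" c d]
        by (intro borel_measurable_times[OF borel_measurable_integrable[OF hi]])
           (auto intro!: borel_measurable_continuous_onI measurable_completion)
      show "AE x in lebesgue. norm (indicator {c..d} x * h x * bump (real (Suc n)) c d x) \<le> \<bar>indicator {c..d} x * h x\<bar>" for n
        using bump_nonneg[of "real (Suc n)" c d] bump_le_1[of "real (Suc n)" c d]
        by (intro AE_I2) (auto simp: abs_mult mult_left_le simp del: of_nat_Suc split: split_indicator)
      show "AE x in lebesgue. (\<lambda>n. indicator {c..d} x * h x * bump (real (Suc n)) c d x)
          \<longlonglongrightarrow> indicator {c..d} x * h x * indicator {c<..<d} x"
        by (intro AE_I2 tendsto_intros bump_tendsto_indicator)
      show "(\<lambda>x. indicator {c..d} x * h x * indicator {c<..<d} x) \<in> borel_measurable lebesgue"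
        by (intro borel_measurable_times[OF borel_measurable_integrable[OF hi]] borel_measurable_indicator) auto
    qed (use hi in simp)
    with eq have "0 = (LINT x|lebesgue. indicator {c..d} x * h x * indicator {c<..<d} x)"
      by (simp add: LIMSEQ_const_iff)
    also have "\<dots> = (LINT x:{c<..<d}|lebesgue. h x)"
      unfolding set_lebesgue_integral_def
      by (intro Bochner_Integration.integral_cong) (auto split: split_indicator)
    finally show ?thesis by simp
  qed
  have sub: "AE x in lebesgue. x \<in> {c<..<d} \<longrightarrow> h x = 0" if cd: "a < c" "d < b" for c d
  proof -
    have "set_integrable lebesgue {c..d} h"
      by (rule locally_integrable_Icc[OF loc cd])
    then have "set_integrable lebesgue {c<..<d} h"
      by (rule set_integrable_subset) auto
    then have "AE x in lebesgue. indicator {c<..<d} x * h x = 0"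
    proof (intro AE_zero_if_interval_integrals_zero)
      fix c' d'
      have "(LINT x:{c'<..<d'}|lebesgue. indicator {c<..<d} x * h x)
          = (LINT x:{max c c'<..<min d d'}|lebesgue. h x)"
        unfolding set_lebesgue_integral_def
        by (intro Bochner_Integration.integral_cong) (auto split: split_indicator)
      with interval[of "max c c'" "min d d'"] cd
      show "(LINT x:{c'<..<d'}|lebesgue. indicator {c<..<d} x * h x) = 0" by auto
    qed (simp add: set_integrable_def)
    then show ?thesis by (auto elim!: eventually_mono split: split_indicator_asm)
  qed
  have "AE x in lebesgue. \<forall>n. x \<in> {a + inverse (real (Suc n))<..<b - inverse (real (Suc n))} \<longrightarrow> h x = 0"
    by (subst AE_all_countable) (intro allI sub; simp del: of_nat_Suc)
  then show ?thesis
  proof (rule eventually_mono, intro impI)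
    fix x
    assume *: "\<forall>n. x \<in> {a + inverse (real (Suc n))<..<b - inverse (real (Suc n))} \<longrightarrow> h x = 0"
      and "x \<in> {a<..<b}"
    then obtain n where "inverse (real (Suc n)) < min (x - a) (b - x)"
      using reals_Archimedean[of "min (x - a) (b - x)"] by auto
    then have "x \<in> {a + inverse (real (Suc n))<..<b - inverse (real (Suc n))}"
      by auto
    with * show "h x = 0" by blast
  qed
qed

lemma locally_integrable_mult_test_fun:
  assumes loc: "locally_integrable a b h" and \<phi>: "test_fun a b \<phi>"
  shows "set_integrable lebesgue {a<..<b} (\<lambda>x. h x * \<phi> x)"
proof -
  from \<phi> obtain K where K: "compact K" "K \<subseteq> {a<..<b}" "\<And>x. x \<notin> K \<Longrightarrow> \<phi> x = 0"
    unfolding test_fun_def by blast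
  have "\<phi> differentiable (at x)" for x
    using \<phi> unfolding test_fun_def by (metis funpow_0)
  then have cont: "continuous_on A \<phi>" for A
    by (simp add: continuous_at_imp_continuous_on differentiable_imp_continuous_within)
  obtain B where B: "\<And>x. x \<in> K \<Longrightarrow> \<bar>\<phi> x\<bar> \<le> B"
    using compact_imp_bounded[OF compact_continuous_image[OF cont K(1)]]
    by (auto simp: bounded_iff)
  have hK: "integrable lebesgue (\<lambda>x. indicator K x * h x)"
    using loc K unfolding locally_integrable_def set_integrable_def by auto
  have "integrable lebesgue (\<lambda>x. (indicator K x * h x) * \<phi> x)"
  proof (rule Bochner_Integration.integrable_bound)
    show "integrable lebesgue (\<lambda>x. B * (indicator K x * h x))"
      using hK by (intro integrable_mult_right) auto
    show "(\<lambda>x. (indicator K x * h x) * \<phi> x) \<in> borel_measurable lebesgue"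
      using cont[of UNIV]
      by (intro borel_measurable_times[OF borel_measurable_integrable[OF hK]])
         (auto intro!: borel_measurable_continuous_onI measurable_completion)
    show "AE x in lebesgue. norm ((indicator K x * h x) * \<phi> x) \<le> norm (B * (indicator K x * h x))"
    proof (intro AE_I2)
      fix x show "norm ((indicator K x * h x) * \<phi> x) \<le> norm (B * (indicator K x * h x))"
        using B[of x] by (auto simp: abs_mult mult.commute split: split_indicator intro!: mult_right_mono)
    qed
  qed
  moreover have "(indicator K x * h x) * \<phi> x = indicator {a<..<b} x *\<^sub>R (h x * \<phi> x)" for x
    using K(2,3) by (auto split: split_indicator)
  ultimately show ?thesis
    unfolding set_integrable_def by simp
qed

lemma weak_deriv_unique:
  assumes "has_weak_deriv a b k f g" "has_weak_deriv a b k f g'"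
  shows "AE x in lebesgue. x \<in> {a<..<b} \<longrightarrow> g x = g' x"
proof -
  have loc: "locally_integrable a b g" "locally_integrable a b g'"
    using assms by (auto simp: has_weak_deriv_def)
  then have "locally_integrable a b (\<lambda>x. g x - g' x)"
    by (auto simp: locally_integrable_def)
  then have "AE x in lebesgue. x \<in> {a<..<b} \<longrightarrow> g x - g' x = 0"
  proof (rule AE_zero_if_test_integrals_zero)
    fix \<phi> assume \<phi>: "test_fun a b \<phi>"
    have "(LINT x:{a<..<b}|lebesgue. (g x - g' x) * \<phi> x) =
        (LINT x:{a<..<b}|lebesgue. g x * \<phi> x) - (LINT x:{a<..<b}|lebesgue. g' x * \<phi> x)"
      unfolding left_diff_distrib
      by (intro set_integral_diff locally_integrable_mult_test_fun loc \<phi>)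
    also have "(-1) ^ k * \<dots> = 0"
      using assms \<phi> by (simp add: has_weak_deriv_def right_diff_distrib)
    finally show "(LINT x:{a<..<b}|lebesgue. (g x - g' x) * \<phi> x) = 0" by simp
  qed
  then show ?thesis by simp
qed

text \<open>The weak derivative is an arbitrary choice among locally integrable candidates, so nothing is known
  about it directly. Uniqueness identifies it almost everywhere with the essentially bounded
  candidate that membership in the Sobolev space provides. This is what makes its essential
  supremum finite, hence its real-valued norm a genuine bound and not the default value \<open>0\<close>.\<close>

lemma sobolev_weak_deriv:
  assumes "f \<in> sobolev_inf k a b" "k \<ge> 1"
  defines "g \<equiv> weak_deriv a b k f"
  shows "has_weak_deriv a b k f g"
    and "AE x in lebesgue. x \<in> {a<..<b} \<longrightarrow> \<bar>g x\<bar> \<le> Linf_norm a b g"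
proof -
  let ?L = "lebesgue_on {a<..<b}"
  obtain g' where g': "g' \<in> Linf a b" "has_weak_deriv a b k f g'"
    using assms(1,2) unfolding sobolev_inf_def by fastforce
  then show wg: "has_weak_deriv a b k f g"
    unfolding g_def weak_deriv_def by (metis someI)
  have meas: "g \<in> borel_measurable ?L" "g' \<in> borel_measurable ?L"
    using wg g' by (auto simp: has_weak_deriv_def Linf_def intro: locally_integrable_measurable)
  have "AE x in ?L. g x = g' x"
    using weak_deriv_unique[OF wg g'(2)] by (subst AE_restrict_space_iff) auto
  then have "esssup ?L (\<lambda>x. ereal \<bar>g x\<bar>) = esssup ?L (\<lambda>x. ereal \<bar>g' x\<bar>)"
    using meas by (intro esssup_AE_cong) (auto elim!: eventually_mono)
  also have "\<dots> < \<infinity>" using g' by (simp add: Linf_def)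
  finally have fin: "esssup ?L (\<lambda>x. ereal \<bar>g x\<bar>) < \<infinity>" .
  have "AE x in ?L. ereal \<bar>g x\<bar> \<le> esssup ?L (\<lambda>x. ereal \<bar>g x\<bar>)"
    by (rule esssup_AE)
  then have "AE x in ?L. \<bar>g x\<bar> \<le> Linf_norm a b g"
  proof (rule eventually_mono)
    fix x assume "ereal \<bar>g x\<bar> \<le> esssup ?L (\<lambda>x. ereal \<bar>g x\<bar>)"
    with fin show "\<bar>g x\<bar> \<le> Linf_norm a b g"
      unfolding Linf_norm_def by (cases "esssup ?L (\<lambda>x. ereal \<bar>g x\<bar>)") auto
  qed
  then show "AE x in lebesgue. x \<in> {a<..<b} \<longrightarrow> \<bar>g x\<bar> \<le> Linf_norm a b g"
    by (subst (asm) AE_restrict_space_iff) auto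
qed

section \<open>Approximation of Sobolev functions by mollification\<close>

lemma bump_mass:
  assumes "0 < \<epsilon>" "a + \<epsilon> \<le> s" "s \<le> b - \<epsilon>"
  shows "integral {a..b} (bump 1 (s - \<epsilon>) (s + \<epsilon>)) = integral {-\<epsilon>..\<epsilon>} (bump 1 (-\<epsilon>) \<epsilon>)"
proof -
  have "integral {-\<epsilon>..\<epsilon>} (bump 1 (s - \<epsilon>) (s + \<epsilon>) \<circ> (\<lambda>x. x + s))
      = integral {-\<epsilon> + s..\<epsilon> + s} (bump 1 (s - \<epsilon>) (s + \<epsilon>))"
    by (rule integral_shift[OF bump_continuous])
  moreover have "bump 1 (s - \<epsilon>) (s + \<epsilon>) \<circ> (\<lambda>x. x + s) = bump 1 (-\<epsilon>) \<epsilon>"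
    using bump_shift[of 1 "-\<epsilon>" s \<epsilon>] by (auto simp: add.commute)
  moreover have "(bump 1 (s - \<epsilon>) (s + \<epsilon>) has_integral
      integral {-\<epsilon> + s..\<epsilon> + s} (bump 1 (s - \<epsilon>) (s + \<epsilon>))) {a..b}"
    using assms
    by (intro has_integral_on_superset[OF integrable_integral] integrable_continuous_interval
        bump_continuous bump_outside) auto
  ultimately show ?thesis by (simp add: integral_unique)
qed

lemma bump_mass_pos:
  assumes "0 < \<epsilon>"
  shows "0 < integral {-\<epsilon>..\<epsilon>} (bump 1 (-\<epsilon>) \<epsilon>)"
proof -
  have "integral {-\<epsilon>..\<epsilon>} (bump 1 (-\<epsilon>) \<epsilon>) \<noteq> 0"
    using integral_eq_0_iff[OF bump_continuous, of "-\<epsilon>" \<epsilon> 1 "-\<epsilon>" \<epsilon>] bump_nonneg bump_pos[of 1 0 "-\<epsilon>" \<epsilon>] assms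
    by force
  moreover have "0 \<le> integral {-\<epsilon>..\<epsilon>} (bump 1 (-\<epsilon>) \<epsilon>)"
    by (intro integral_nonneg integrable_continuous_interval bump_continuous) (simp add: bump_nonneg)
  ultimately show ?thesis by simp
qed

text \<open>For \<open>k = 0\<close> this is the average of \<open>f\<close> against the normalised bump around \<open>s\<close>; for general \<open>k\<close> it
  is the \<open>k\<close>-th derivative of that average in \<open>s\<close>. The sign records that the kernel depends on
  \<open>y - s\<close>.\<close>

definition mollify :: "real \<Rightarrow> real \<Rightarrow> real \<Rightarrow> (real \<Rightarrow> real) \<Rightarrow> nat \<Rightarrow> real \<Rightarrow> real" where
  "mollify a b \<epsilon> f k s =
     (-1) ^ k * integral {a..b} (\<lambda>y. f y * (deriv ^^ k) (bump 1 (-\<epsilon>) \<epsilon>) (y - s))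
       / integral {-\<epsilon>..\<epsilon>} (bump 1 (-\<epsilon>) \<epsilon>)"

text \<open>Differentiation under the integral sign: all the dependence on \<open>s\<close> sits in the smooth kernel.\<close>

lemma mollify_DERIV:
  assumes "continuous_on {a..b} f"
  shows "(mollify a b \<epsilon> f k has_real_derivative mollify a b \<epsilon> f (Suc k) s) (at s)"
proof -
  let ?\<rho> = "\<lambda>k. (deriv ^^ k) (bump 1 (-\<epsilon>) \<epsilon>)"
  have "((\<lambda>s. integral (cbox a b) (\<lambda>y. f y * ?\<rho> k (y - s))) has_real_derivative
      integral (cbox a b) (\<lambda>y. - (f y * ?\<rho> (Suc k) (y - s)))) (at s within UNIV)"
  proof (rule leibniz_rule_field_derivative)
    show "((\<lambda>s. f y * ?\<rho> k (y - s)) has_real_derivative - (f y * ?\<rho> (Suc k) (y - s))) (at s within UNIV)" for s y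
    proof -
      have "((\<lambda>s. y - s) has_real_derivative - 1) (at s)"
        by (auto intro!: derivative_eq_intros)
      from DERIV_cmult[OF DERIV_chain2[OF bump_higher_deriv_DERIV this], where c = "f y"]
      show ?thesis by simp
    qed
    show "(\<lambda>y. f y * ?\<rho> k (y - s)) integrable_on cbox a b" for s
      using assms
      by (intro integrable_continuous continuous_intros
          continuous_on_compose2[OF bump_higher_deriv_continuous[of UNIV]]) auto
    show "continuous_on (UNIV \<times> cbox a b) (\<lambda>(s, y). - (f y * ?\<rho> (Suc k) (y - s)))"
      unfolding case_prod_beta
      by (intro continuous_intros continuous_on_compose2[OF bump_higher_deriv_continuous[of UNIV]]
          continuous_on_compose2[OF assms]) auto
  qed auto
  from DERIV_cmult[OF this, where c = "(-1) ^ k / integral {-\<epsilon>..\<epsilon>} (bump 1 (-\<epsilon>) \<epsilon>)"]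
  show ?thesis
    unfolding mollify_def [abs_def] by (simp add: mult.commute)
qed

lemma mollify_close:
  assumes "0 < \<epsilon>" "a + \<epsilon> \<le> s" "s \<le> b - \<epsilon>" and cont: "continuous_on {a..b} f"
    and close: "\<And>y. y \<in> {a..b} \<Longrightarrow> \<bar>y - s\<bar> < \<epsilon> \<Longrightarrow> \<bar>f y - f s\<bar> \<le> \<eta>"
  shows "\<bar>mollify a b \<epsilon> f 0 s - f s\<bar> \<le> \<eta>"
proof -
  let ?\<phi> = "bump 1 (s - \<epsilon>) (s + \<epsilon>)"
  let ?I = "integral {-\<epsilon>..\<epsilon>} (bump 1 (-\<epsilon>) \<epsilon>)"
  have I: "0 < ?I" using bump_mass_pos assms by blast
  have \<phi>: "bump 1 (-\<epsilon>) \<epsilon> (y - s) = ?\<phi> y" for y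
    using bump_shift[of 1 "-\<epsilon>" s \<epsilon> y] by (simp add: add.commute)
  have mass: "integral {a..b} ?\<phi> = ?I"
    using bump_mass assms by blast
  have int: "(\<lambda>y. f y * ?\<phi> y) integrable_on {a..b}" "(\<lambda>y. c * ?\<phi> y) integrable_on {a..b}" for c
    using cont by (auto intro!: integrable_continuous_interval continuous_intros bump_continuous)
  have "?I * (mollify a b \<epsilon> f 0 s - f s) = integral {a..b} (\<lambda>y. f y * ?\<phi> y) - f s * ?I"
    using I by (simp add: mollify_def \<phi> right_diff_distrib mult.commute)
  also have "\<dots> = integral {a..b} (\<lambda>y. f y * ?\<phi> y) - f s * integral {a..b} ?\<phi>"
    by (simp only: mass)
  also have "\<dots> = integral {a..b} (\<lambda>y. (f y - f s) * ?\<phi> y)"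
    using int by (simp add: left_diff_distrib integral_diff)
  also have "\<bar>\<dots>\<bar> \<le> integral {a..b} (\<lambda>y. \<eta> * ?\<phi> y)"
  proof -
    have "norm (integral {a..b} (\<lambda>y. (f y - f s) * ?\<phi> y)) \<le> integral {a..b} (\<lambda>y. \<eta> * ?\<phi> y)"
    proof (rule integral_norm_bound_integral)
      show "(\<lambda>y. (f y - f s) * ?\<phi> y) integrable_on {a..b}"
        using int by (simp add: left_diff_distrib integrable_diff)
      show "norm ((f y - f s) * ?\<phi> y) \<le> \<eta> * ?\<phi> y" if "y \<in> {a..b}" for y
      proof (cases "\<bar>y - s\<bar> < \<epsilon>")
        case True
        then show ?thesis
          using close[OF that] bump_nonneg[of 1 "s - \<epsilon>" "s + \<epsilon>" y]
          by (auto simp: abs_mult intro: mult_right_mono)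
      next
        case False
        then show ?thesis by (subst (1 2) bump_outside) auto
      qed
    qed (rule int)
    then show ?thesis by simp
  qed
  also have "\<dots> = ?I * \<eta>" by (simp add: mass)
  finally show ?thesis
    using I by (simp add: abs_mult)
qed

text \<open>The definition of the weak derivative moves the three derivatives from the kernel to \<open>f\<close>, so the
  third derivative of the average is the average of \<open>g\<close> with a nonnegative kernel of mass one.
  The kernel must be a test function on \<open>(a, b)\<close>, which is why \<open>s\<close> keeps a distance larger than
  \<open>\<epsilon>\<close> from the end points.\<close>

lemma mollify_third_deriv_bound:
  assumes "0 < \<epsilon>" "a + \<epsilon> < s" "s < b - \<epsilon>" and cont: "continuous_on {a..b} f"
    and wd: "has_weak_deriv a b 3 f g"
    and bound: "AE x in lebesgue. x \<in> {a<..<b} \<longrightarrow> \<bar>g x\<bar> \<le> M"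
  shows "\<bar>mollify a b \<epsilon> f 3 s\<bar> \<le> M"
proof -
  let ?\<phi> = "bump 1 (s - \<epsilon>) (s + \<epsilon>)"
  let ?I = "integral {-\<epsilon>..\<epsilon>} (bump 1 (-\<epsilon>) \<epsilon>)"
  have I: "0 < ?I" using bump_mass_pos assms by blast
  have test: "test_fun a b ?\<phi>" using assms by (intro bump_test_fun) auto
  have \<phi>3: "(deriv ^^ 3) (bump 1 (-\<epsilon>) \<epsilon>) (y - s) = (deriv ^^ 3) ?\<phi> y" for y
    using fun_cong[OF bump_higher_deriv_shift[of 3 1 "-\<epsilon>" s \<epsilon>], of y] by (simp add: add.commute)
  have "continuous_on {a..b} (\<lambda>y. f y * (deriv ^^ 3) ?\<phi> y)"
    by (intro continuous_intros cont bump_higher_deriv_continuous)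
  then have "set_integrable lebesgue {a..b} (\<lambda>y. f y * (deriv ^^ 3) ?\<phi> y)"
    by (rule absolutely_integrable_continuous_real)
  then have "set_integrable lebesgue {a<..<b} (\<lambda>y. f y * (deriv ^^ 3) ?\<phi> y)"
    by (rule set_integrable_subset) auto
  then have "(LINT x:{a<..<b}|lebesgue. f x * (deriv ^^ 3) ?\<phi> x) = integral {a..b} (\<lambda>y. f y * (deriv ^^ 3) ?\<phi> y)"
    by (simp add: set_lebesgue_integral_eq_integral integral_open_interval_real)
  moreover have "(LINT x:{a<..<b}|lebesgue. f x * (deriv ^^ 3) ?\<phi> x) =
        - (LINT x:{a<..<b}|lebesgue. g x * ?\<phi> x)"
    using wd test unfolding has_weak_deriv_def by simp
  ultimately have "?I * mollify a b \<epsilon> f 3 s = (LINT x:{a<..<b}|lebesgue. g x * ?\<phi> x)"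
    using I by (simp add: mollify_def \<phi>3)
  moreover have "\<bar>LINT x:{a<..<b}|lebesgue. g x * ?\<phi> x\<bar> \<le> M * ?I"
  proof -
    have "set_integrable lebesgue {a<..<b} (\<lambda>x. g x * ?\<phi> x)"
      using wd test by (intro locally_integrable_mult_test_fun) (auto simp: has_weak_deriv_def)
    then have int: "integrable lebesgue (\<lambda>x. indicator {a<..<b} x * (g x * ?\<phi> x))"
      by (simp add: set_integrable_def)
    have "set_integrable lebesgue {a..b} (\<lambda>x. M * ?\<phi> x)"
      by (intro absolutely_integrable_continuous_real continuous_intros bump_continuous)
    then have si: "set_integrable lebesgue {a<..<b} (\<lambda>x. M * ?\<phi> x)"
      by (rule set_integrable_subset) auto
    then have int': "integrable lebesgue (\<lambda>x. indicator {a<..<b} x * (M * ?\<phi> x))"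
      by (simp add: set_integrable_def)
    have "\<bar>LINT x:{a<..<b}|lebesgue. g x * ?\<phi> x\<bar> \<le> (LINT x|lebesgue. \<bar>indicator {a<..<b} x * (g x * ?\<phi> x)\<bar>)"
      unfolding set_lebesgue_integral_def real_scaleR_def by (rule integral_abs_bound)
    also have "\<dots> \<le> (LINT x|lebesgue. indicator {a<..<b} x * (M * ?\<phi> x))"
    proof (rule integral_mono_AE)
      show "AE x in lebesgue. \<bar>indicator {a<..<b} x * (g x * ?\<phi> x)\<bar> \<le> indicator {a<..<b} x * (M * ?\<phi> x)"
        using bound
        by (rule eventually_mono)
           (auto simp: abs_mult bump_nonneg intro!: mult_right_mono split: split_indicator)
    qed (use int int' in auto)
    also have "\<dots> = (LINT x:{a<..<b}|lebesgue. M * ?\<phi> x)"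
      by (simp only: set_lebesgue_integral_def real_scaleR_def)
    also have "\<dots> = integral {a..b} (\<lambda>x. M * ?\<phi> x)"
      by (simp only: set_lebesgue_integral_eq_integral(2)[OF si] integral_open_interval_real)
    also have "\<dots> = M * ?I"
      using bump_mass[of \<epsilon> a s b] assms by simp
    finally show ?thesis .
  qed
  ultimately have "\<bar>?I * mollify a b \<epsilon> f 3 s\<bar> \<le> M * ?I"
    by simp
  also have "\<bar>?I * mollify a b \<epsilon> f 3 s\<bar> = \<bar>mollify a b \<epsilon> f 3 s\<bar> * ?I"
    using I by (simp add: abs_mult)
  finally show ?thesis using I by simp
qed

text \<open>Mollification is only available at a distance from the end points, whereas the quasi-interpolant
  samples \<open>f\<close> at \<open>a\<close> and \<open>b\<close>. Composing with the contraction \<open>A\<close> of \<open>[a, b]\<close> towards its midpoint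
  repairs this: it moves points by little, and it multiplies the third derivative by
  \<open>(1 - \<delta>)\<^sup>3 \<le> 1\<close>, so the bound \<open>M\<close> survives exactly.\<close>

lemma smooth_approximation:
  fixes f g :: "real \<Rightarrow> real"
  assumes "a < b" and cont: "continuous_on {a..b} f" and wd: "has_weak_deriv a b 3 f g"
    and bound: "AE x in lebesgue. x \<in> {a<..<b} \<longrightarrow> \<bar>g x\<bar> \<le> M"
    and "\<eta> > 0"
  obtains D :: "nat \<Rightarrow> real \<Rightarrow> real" where
    "\<And>k x. (D k has_real_derivative D (Suc k) x) (at x)"
    "\<And>x. x \<in> {a..b} \<Longrightarrow> \<bar>D 3 x\<bar> \<le> M"
    "\<And>x. x \<in> {a..b} \<Longrightarrow> \<bar>D 0 x - f x\<bar> \<le> \<eta>"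
proof -
  obtain d where d: "d > 0" "\<And>y y'. y \<in> {a..b} \<Longrightarrow> y' \<in> {a..b} \<Longrightarrow> \<bar>y' - y\<bar> < d \<Longrightarrow> \<bar>f y' - f y\<bar> < \<eta> / 2"
    using compact_uniformly_continuous[OF cont] \<open>\<eta> > 0\<close>
    unfolding uniformly_continuous_on_def dist_real_def
    by (metis compact_Icc half_gt_zero)
  \<comment> \<open>The contraction moves points by at most \<open>\<delta> (b - a) / 2\<close>; this is also its gap to the end points, and \<open>\<epsilon>\<close> is half of it.\<close>
  define \<delta> where "\<delta> = min (1/2) (d / (2 * (b - a)))"
  have \<delta>: "0 < \<delta>" "\<delta> < 1"
    using \<open>a < b\<close> d(1) by (auto simp: \<delta>_def)
  have "\<delta> * (b - a) \<le> d / (2 * (b - a)) * (b - a)"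
    using \<open>a < b\<close> by (intro mult_right_mono) (auto simp: \<delta>_def)
  also have "\<dots> = d / 2"
    using \<open>a < b\<close> by (simp add: divide_simps)
  finally have \<delta>d: "\<delta> * (b - a) < d"
    using d(1) by simp
  define \<epsilon> where "\<epsilon> = \<delta> * (b - a) / 4"
  have "0 < \<delta> * (b - a)"
    using \<delta> \<open>a < b\<close> by simp
  then have \<epsilon>: "0 < \<epsilon>" "\<epsilon> < d"
    using \<delta>d by (auto simp: \<epsilon>_def)
  define A where "A x = (1 - \<delta>) * x + \<delta> * ((a + b) / 2)" for x
  have A: "a + \<epsilon> < A x" "A x < b - \<epsilon>" "\<bar>A x - x\<bar> < d" if "x \<in> {a..b}" for x
  proof -
    have "(1 - \<delta>) * a \<le> (1 - \<delta>) * x" "(1 - \<delta>) * x \<le> (1 - \<delta>) * b"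
      using that \<delta> by (auto intro: mult_left_mono)
    then show "a + \<epsilon> < A x" "A x < b - \<epsilon>"
      using \<epsilon>(1) by (auto simp: A_def \<epsilon>_def field_simps)
    have "A x - x = \<delta> * ((a + b) / 2 - x)"
      by (simp add: A_def field_simps)
    also have "\<bar>\<dots>\<bar> \<le> \<delta> * (b - a)"
    proof -
      have "\<bar>(a + b) / 2 - x\<bar> \<le> b - a"
        using that unfolding abs_le_iff by (auto simp: field_simps)
      then show ?thesis using \<delta> by (simp add: abs_mult)
    qed
    finally show "\<bar>A x - x\<bar> < d" using \<delta>d by simp
  qed
  define D where "D k x = (1 - \<delta>) ^ k * mollify a b \<epsilon> f k (A x)" for k x
  show ?thesis
  proof (rule that[of D])
    show "(D k has_real_derivative D (Suc k) x) (at x)" for k x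
    proof -
      have "(A has_real_derivative 1 - \<delta>) (at x)"
        unfolding A_def [abs_def] by (auto intro!: derivative_eq_intros)
      from DERIV_cmult[OF DERIV_chain2[OF mollify_DERIV[OF cont] this], where c = "(1 - \<delta>) ^ k"]
      show ?thesis
        unfolding D_def [abs_def] by (simp add: ac_simps)
    qed
    fix x assume x: "x \<in> {a..b}"
    have "\<bar>mollify a b \<epsilon> f 3 (A x)\<bar> \<le> M"
      by (rule mollify_third_deriv_bound[OF \<epsilon>(1) A(1,2)[OF x] cont wd bound])
    moreover have "(1 - \<delta>) ^ 3 \<le> 1" "0 \<le> (1 - \<delta>) ^ 3"
      using \<delta> by (auto intro: power_le_one)
    ultimately show "\<bar>D 3 x\<bar> \<le> M"
      unfolding D_def by (metis abs_ge_zero abs_mult abs_of_nonneg mult_left_le_one_le order_trans)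
    have "\<bar>mollify a b \<epsilon> f 0 (A x) - f (A x)\<bar> \<le> \<eta> / 2"
      using A[OF x] \<epsilon> d(2)[of "A x"]
      by (intro mollify_close cont less_imp_le) (auto intro!: less_imp_le)
    moreover have "\<bar>f (A x) - f x\<bar> < \<eta> / 2"
      using A[OF x] x \<epsilon> by (intro d(2)) auto
    moreover have "D 0 x = mollify a b \<epsilon> f 0 (A x)"
      by (simp add: D_def)
    ultimately show "\<bar>D 0 x - f x\<bar> \<le> \<eta>"
      by linarith
  qed
qed

section \<open>The spline quasi-interpolant on one knot interval\<close>

lemma knot_mono:
  assumes "is_partition a b n x" "i \<le> j"
  shows "knot n x i \<le> knot n x j"
proof -
  have "strict_mono_on {0..n} x"
    using assms(1) by (simp add: is_partition_def)
  moreover have "nat (max 0 (min i (int n))) \<le> nat (max 0 (min j (int n)))"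
    using assms(2) by (intro nat_mono) auto
  ultimately show ?thesis
    unfolding knot_def by (elim strict_mono_on_leD) auto
qed

lemma knot_strict_mono:
  assumes "is_partition a b n x" "0 \<le> i" "i < j" "j \<le> int n"
  shows "knot n x i < knot n x j"
proof -
  have "strict_mono_on {0..n} x"
    using assms(1) by (simp add: is_partition_def)
  then have "x (nat i) < x (nat j)"
    by (rule strict_mono_onD) (use assms in auto)
  then show ?thesis
    using assms by (simp add: knot_def)
qed

lemma knot_in_Icc:
  assumes "is_partition a b n x"
  shows "knot n x i \<in> {a..b}"
proof -
  have "knot n x (min i 0) = a" "knot n x (max i (int n)) = b"
    using assms by (auto simp: knot_def is_partition_def)
  then show ?thesis
    using knot_mono[OF assms, of "min i 0" i] knot_mono[OF assms, of i "max i (int n)"] by auto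
qed

lemma theta_in_Icc:
  assumes "is_partition a b n x"
  shows "theta n x i \<in> {a..b}"
  using knot_in_Icc[OF assms, of i] knot_in_Icc[OF assms, of "i - 1"]
  by (auto simp: theta_def)

lemma step_nonneg: "is_partition a b n x \<Longrightarrow> 0 \<le> step n x i"
  using knot_mono[of a b n x "i - 1" i] by (simp add: step_def)

lemma step_pos: "is_partition a b n x \<Longrightarrow> 1 \<le> i \<Longrightarrow> i \<le> int n \<Longrightarrow> 0 < step n x i"
  using knot_strict_mono[of a b n x "i - 1" i] by (simp add: step_def)

lemma step_eq_0: "i \<le> 0 \<or> i > int n \<Longrightarrow> step n x i = 0"
  by (auto simp: step_def knot_def)

lemma step_le_mesh:
  assumes "is_partition a b n x" "n \<ge> 1"
  shows "step n x i \<le> mesh n x"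
proof -
  have le: "x k - x (k - 1) \<le> mesh n x" if "k \<in> {1..n}" for k
    unfolding mesh_def using that by (intro Max_ge) auto
  have 1: "step n x (int k) = x k - x (k - 1)" if "k \<in> {1..n}" for k
    using that by (auto simp: step_def knot_def nat_diff_distrib)
  show ?thesis
  proof (cases "1 \<le> i \<and> i \<le> int n")
    case True
    then have "nat i \<in> {1..n}" "int (nat i) = i" by auto
    then show ?thesis using le[of "nat i"] 1[of "nat i"] by simp
  next
    case False
    then have "step n x i = 0" by (intro step_eq_0) auto
    also have "0 \<le> step n x (int 1)" by (rule step_nonneg[OF assms(1)])
    also have "\<dots> \<le> mesh n x" using le[of 1] 1[of 1] assms by auto
    finally show ?thesis .
  qed
qed

lemma sigma_bounds: "is_partition a b n x \<Longrightarrow> 0 \<le> sigma n x i \<and> sigma n x i \<le> 1"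
  using step_nonneg[of a b n x i] step_nonneg[of a b n x "i - 1"]
  by (auto simp: sigma_def divide_le_eq_1)

lemma sigma'_bounds: "is_partition a b n x \<Longrightarrow> 0 \<le> sigma' n x i \<and> sigma' n x i \<le> 1"
  using sigma_bounds[of a b n x i] by (simp add: sigma'_def)

text \<open>The two end functionals are covered by the general formula: there the outer step is \<open>0\<close>, and
  \<open>0 / 0 = 0\<close> makes \<open>\<sigma>\<^sub>0 = \<sigma>\<^bsub>n+1\<^esub> = 0\<close>, so only the middle coefficient \<open>1\<close> survives, and
  \<open>\<theta>\<^sub>0\<close>, \<open>\<theta>\<^bsub>n+1\<^esub>\<close> are the end points. The error estimate
  then has no boundary cases.\<close>

lemma mu_eq:
  assumes "0 \<le> i" "i \<le> int n + 1"
  shows "mu n x i f = coef_a n x i * f (theta n x (i - 1)) + coef_b n x i * f (theta n x i)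
         + coef_c n x i * f (theta n x (i + 1))"
proof -
  have "sigma n x 0 = 0" "sigma n x (int n + 1) = 0"
    by (simp_all add: sigma_def step_eq_0)
  moreover have "theta n x 0 = x 0" "theta n x (int n + 1) = x n"
    by (simp_all add: theta_def knot_def)
  ultimately show ?thesis
    by (auto simp: mu_def coef_a_def coef_b_def coef_c_def)
qed

lemma mu_add:
  "mu n x i (\<lambda>t. f t + g t) = mu n x i f + mu n x i g"
  by (simp add: mu_def algebra_simps)

text \<open>The value on the right is the blossom (polar form) of the quadratic at the pair of knots
  \<open>x\<^bsub>i-1\<^esub>, x\<^sub>i\<close>, which is the B-spline coefficient of that quadratic. In terms of
  \<open>e = - s s' / (s + s')\<close> the coefficients are \<open>e s\<close>, \<open>1 - e (s + s')\<close>, \<open>e s'\<close>, while the outer nodes lie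
  at \<open>-h / (2 s)\<close> and \<open>h / (2 s')\<close> from \<open>\<theta>\<^sub>i\<close>. Hence the zeroth and first moments about
  \<open>\<theta>\<^sub>i\<close> are \<open>1\<close> and \<open>0\<close>, and the second is \<open>- h\<^sup>2 / 4\<close>, as it is for the blossom.\<close>

lemma mu_quadratic:
  fixes \<alpha> \<beta> \<gamma> c :: real
  assumes part: "is_partition a b n x" and i: "0 \<le> i" "i \<le> int n + 1"
  shows "mu n x i (\<lambda>t. \<alpha> + \<beta> * (t - c) + \<gamma> * (t - c)\<^sup>2) =
    \<alpha> + \<beta> * ((knot n x (i - 1) + knot n x i) / 2 - c) + \<gamma> * (knot n x (i - 1) - c) * (knot n x i - c)"
proof (cases "1 \<le> i \<and> i \<le> int n")
  case False
  then have "i = 0 \<or> i = int n + 1" using i by auto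
  then show ?thesis
    by (auto simp: mu_def knot_def power2_eq_square)
next
  case True
  define h where "h = step n x i"
  define s where "s = sigma n x i"
  define s' where "s' = sigma' n x (i + 1)"
  define e where "e = - (s * s' / (s + s'))"
  define d where "d = theta n x i - c"
  have h: "h > 0" using step_pos[OF part] True by (simp add: h_def)
  have nn: "step n x (i - 1) \<ge> 0" "step n x (i + 1) \<ge> 0"
    using step_nonneg[OF part] by blast+
  have s: "s = h / (step n x (i - 1) + h)" "s > 0"
    using h nn by (auto simp: s_def sigma_def h_def)
  have s': "s' = h / (h + step n x (i + 1))" "s' > 0"
    using h nn by (auto simp: s'_def sigma'_def sigma_def h_def field_simps)
  have th: "theta n x (i - 1) - c = d - h / (2 * s)" "theta n x (i + 1) - c = d + h / (2 * s')"
    using h nn by (auto simp: s(1) s'(1) h_def d_def theta_def step_def field_simps)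
  have abc: "coef_a n x i = e * s" "coef_c n x i = e * s'" "coef_b n x i = 1 - e * (s + s')"
    using s(2) s'(2) unfolding coef_a_def coef_b_def coef_c_def s_def[symmetric] s'_def[symmetric] e_def
    by (simp_all add: power2_eq_square)
  have e: "e / s + e / s' = - 1"
  proof -
    have "e / s + e / s' = - ((s + s') / (s + s'))"
      using s(2) s'(2) unfolding add_divide_distrib e_def by simp
    then show ?thesis using s(2) s'(2) by simp
  qed
  have one: "coef_a n x i + coef_b n x i + coef_c n x i = 1"
    by (simp add: abc algebra_simps)
  have lin: "coef_a n x i * (d - h / (2 * s)) + coef_b n x i * d + coef_c n x i * (d + h / (2 * s')) = d"
    using s(2) s'(2) unfolding abc by (simp add: field_simps)
  have "coef_a n x i * (d - h / (2 * s))\<^sup>2 + coef_b n x i * d\<^sup>2 + coef_c n x i * (d + h / (2 * s'))\<^sup>2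
      = d\<^sup>2 + h\<^sup>2 / 4 * (e / s + e / s')"
    using s(2) s'(2) unfolding abc by (simp add: field_simps power2_eq_square)
  then have quad: "coef_a n x i * (d - h / (2 * s))\<^sup>2 + coef_b n x i * d\<^sup>2 + coef_c n x i * (d + h / (2 * s'))\<^sup>2
      = d\<^sup>2 - h\<^sup>2 / 4"
    by (simp add: e)
  have "mu n x i (\<lambda>t. \<alpha> + \<beta> * (t - c) + \<gamma> * (t - c)\<^sup>2) =
      \<alpha> * (coef_a n x i + coef_b n x i + coef_c n x i)
    + \<beta> * (coef_a n x i * (d - h / (2 * s)) + coef_b n x i * d + coef_c n x i * (d + h / (2 * s')))
    + \<gamma> * (coef_a n x i * (d - h / (2 * s))\<^sup>2 + coef_b n x i * d\<^sup>2 + coef_c n x i * (d + h / (2 * s'))\<^sup>2)"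
    unfolding mu_eq[OF i] th d_def[symmetric] by (simp add: algebra_simps)
  also have "\<dots> = \<alpha> + \<beta> * d + \<gamma> * (d\<^sup>2 - h\<^sup>2 / 4)"
    unfolding one lin quad by simp
  also have "d\<^sup>2 - h\<^sup>2 / 4 = (knot n x (i - 1) - c) * (knot n x i - c)"
    by (simp add: d_def h_def theta_def step_def field_simps power2_eq_square)
  finally show ?thesis
    by (simp add: d_def theta_def)
qed

text \<open>The two outer weights are nonpositive and add up to \<open>- s s'\<close>; this controls them also when
  \<open>s + s'\<close> is small or zero.\<close>

lemma coef_bounds:
  assumes part: "is_partition a b n x"
  defines "s \<equiv> \<lambda>i. sigma n x i" and "s' \<equiv> \<lambda>i. sigma' n x (i + 1)"
  shows "\<bar>coef_a n x i\<bar> + \<bar>coef_c n x i\<bar> = s i * s' i" "coef_b n x i = 1 + s i * s' i"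
    "\<bar>coef_a n x i\<bar> \<le> s' i" "\<bar>coef_c n x i\<bar> \<le> s i"
proof -
  have s: "0 \<le> s i" "s i \<le> 1" "0 \<le> s' i" "s' i \<le> 1"
    using sigma_bounds[OF part] sigma'_bounds[OF part] by (auto simp: s_def s'_def)
  have a: "\<bar>coef_a n x i\<bar> = (s i)\<^sup>2 * s' i / (s i + s' i)"
   and c: "\<bar>coef_c n x i\<bar> = s i * (s' i)\<^sup>2 / (s i + s' i)"
    using s by (auto simp: coef_a_def coef_c_def s_def s'_def)
  show ac: "\<bar>coef_a n x i\<bar> + \<bar>coef_c n x i\<bar> = s i * s' i"
  proof (cases "s i + s' i = 0")
    case True
    then have "s i = 0" using s by simp
    then show ?thesis by (simp add: a c)
  next
    case False
    have "\<bar>coef_a n x i\<bar> + \<bar>coef_c n x i\<bar> = (s i * s' i) * (s i + s' i) / (s i + s' i)"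
      unfolding a c add_divide_distrib[symmetric] by (simp add: algebra_simps power2_eq_square)
    with False show ?thesis by simp
  qed
  have "s i * s' i \<le> s i" "s i * s' i \<le> s' i"
    using s by (auto simp: mult_left_le mult_left_le_one_le)
  with ac show "\<bar>coef_a n x i\<bar> \<le> s' i" "\<bar>coef_c n x i\<bar> \<le> s i"
    by linarith+
  show "coef_b n x i = 1 + s i * s' i"
    by (simp add: coef_b_def s_def s'_def)
qed

lemma bspline_0_eq:
  assumes part: "is_partition a b n x" and j: "1 \<le> j" "j \<le> int n"
    and u: "knot n x (j - 1) \<le> u" "u < knot n x j \<or> j = int n \<and> u = x n"
  shows "bspline (knot n x) (x n) 0 k u = (if k = j - 1 then 1 else 0)"
proof -
  have xn: "knot n x (int n) = x n" by (simp add: knot_def)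
  consider "k < j - 1" | "k = j - 1" | "j \<le> k" by linarith
  then show ?thesis
  proof cases
    case 1
    then have "knot n x (k + 1) \<le> knot n x (j - 1)" by (intro knot_mono[OF part]) auto
    moreover have "knot n x (j - 1) < x n"
      using knot_strict_mono[OF part, of "j - 1" "int n"] j xn by simp
    ultimately have "\<not> u < knot n x (k + 1)" "\<not> (u = knot n x (k + 1) \<and> u = x n)"
      using u by linarith+
    with 1 show ?thesis by simp
  next
    case 2
    moreover have "knot n x (j - 1) < knot n x j"
      using knot_strict_mono[OF part, of "j - 1" j] j by simp
    ultimately show ?thesis
      using u xn by auto
  next
    case 3
    have le: "knot n x j \<le> knot n x k" "knot n x k \<le> knot n x (k + 1)"
      by (rule knot_mono[OF part], use 3 in simp)+
    have uj: "u \<le> knot n x j" using u(2) xn by auto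
    have eq: "knot n x k = knot n x (k + 1)" if "u = knot n x j"
      using 3 u(2) that by (auto simp: knot_def)
    have "u < knot n x (k + 1) \<Longrightarrow> \<not> knot n x k \<le> u"
      using le uj eq by linarith
    moreover have "knot n x k < knot n x (k + 1) \<Longrightarrow> u \<noteq> knot n x (k + 1)"
      using le uj by linarith
    ultimately show ?thesis using 3 by auto
  qed
qed

text \<open>Evaluation on one knot interval by de Boor's algorithm: two levels of convex combinations of the
  three active coefficients. Keeping this nested form, instead of the expanded B-splines,
  makes the reproduction of quadratics a matter of affinity.\<close>

lemma quasi_interp_de_boor:
  assumes part: "is_partition a b n x" and j: "1 \<le> j" "j \<le> int n"
    and u: "knot n x (j - 1) \<le> u" "u < knot n x j \<or> j = int n \<and> u = x n"
  defines "\<tau> \<equiv> (u - knot n x (j - 1)) / (knot n x j - knot n x (j - 1))"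
    and "\<omega> \<equiv> (u - knot n x (j - 2)) / (knot n x j - knot n x (j - 2))"
    and "\<omega>' \<equiv> (u - knot n x (j - 1)) / (knot n x (j + 1) - knot n x (j - 1))"
  shows "quasi_interp n x f u =
    (1 - \<tau>) * ((1 - \<omega>) * mu n x (j - 1) f + \<omega> * mu n x j f) +
    \<tau> * ((1 - \<omega>') * mu n x j f + \<omega>' * mu n x (j + 1) f)"
proof -
  let ?t = "knot n x"
  note B0 = bspline_0_eq[OF part j u]
  have B1: "bspline ?t (x n) (Suc 0) k u =
      (if k = j - 1 then (u - ?t (j - 1)) / (?t j - ?t (j - 1))
       else if k = j - 2 then (?t j - u) / (?t j - ?t (j - 1)) else 0)" for k
    unfolding bspline.simps(2) B0 by auto
  have B2: "qB n x i u = (u - ?t (i - 2)) / (?t i - ?t (i - 2)) * bspline ?t (x n) (Suc 0) (i - 2) u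
      + (?t (i + 1) - u) / (?t (i + 1) - ?t (i - 1)) * bspline ?t (x n) (Suc 0) (i - 1) u" for i
  proof -
    have "i - 2 + int (Suc 0) + 1 = i" "i - 2 + int (Suc 0) + 2 = i + 1" "i - 2 + 1 = i - 1"
      by auto
    then show ?thesis
      using bspline.simps(2)[of ?t "x n" "Suc 0" "i - 2" u] by (simp only: qB_def numeral_2_eq_2 One_nat_def)
  qed
  have lt: "?t (j - 1) < ?t j"
    by (rule knot_strict_mono[OF part]) (use j in auto)
  have le: "?t (j - 2) \<le> ?t (j - 1)" "?t j \<le> ?t (j + 1)"
    by (rule knot_mono[OF part], simp)+
  have compl: "1 - (u - p) / (q - p) = (q - u) / (q - p)" if "p < q" for p q
    using that by (simp add: field_simps)
  have \<tau>: "1 - \<tau> = (?t j - u) / (?t j - ?t (j - 1))"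
    and \<omega>: "1 - \<omega> = (?t j - u) / (?t j - ?t (j - 2))"
    and \<omega>': "1 - \<omega>' = (?t (j + 1) - u) / (?t (j + 1) - ?t (j - 1))"
    unfolding \<tau>_def \<omega>_def \<omega>'_def using lt le by (auto intro!: compl)
  have B: "bspline ?t (x n) (Suc 0) (j - 3) u = 0" "bspline ?t (x n) (Suc 0) (j - 2) u = 1 - \<tau>"
    "bspline ?t (x n) (Suc 0) (j - 1) u = \<tau>" "bspline ?t (x n) (Suc 0) j u = 0"
    unfolding B1 \<tau> by (simp_all add: \<tau>_def)
  have q: "qB n x (j - 1) u = (1 - \<omega>) * (1 - \<tau>)"
    "qB n x j u = \<omega> * (1 - \<tau>) + (1 - \<omega>') * \<tau>"
    "qB n x (j + 1) u = \<omega>' * \<tau>"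
    using B2[of "j - 1"] B2[of j] B2[of "j + 1"]
    unfolding \<omega> \<omega>' unfolding \<omega>_def \<omega>'_def by (simp_all add: B del: bspline.simps)
  have zero: "qB n x i u = 0" if "i \<notin> {j - 1, j, j + 1}" for i
    using that unfolding B2 B1 by auto
  have "quasi_interp n x f u = (\<Sum>i\<in>{j - 1, j, j + 1}. mu n x i f * qB n x i u)"
    unfolding quasi_interp_def
    by (rule sum.mono_neutral_right) (use j zero in auto)
  also have "\<dots> = mu n x (j - 1) f * qB n x (j - 1) u + (mu n x j f * qB n x j u + mu n x (j + 1) f * qB n x (j + 1) u)"
    by simp
  finally show ?thesis
    unfolding q by (simp add: algebra_simps)
qed

text \<open>The coefficients are the blossom values \<open>bl\<close> at consecutive knots. Since the blossom is affine in
  each argument, the inner combinations of de Boor's algorithm replace one knot by \<open>u\<close> and the outer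
  one replaces the other, leaving \<open>bl u u\<close>, the value of the quadratic at \<open>u\<close>.\<close>

lemma quasi_interp_quadratic:
  fixes \<alpha> \<beta> \<gamma> c :: real
  assumes part: "is_partition a b n x" and j: "1 \<le> j" "j \<le> int n"
    and u: "knot n x (j - 1) \<le> u" "u < knot n x j \<or> j = int n \<and> u = x n"
  shows "quasi_interp n x (\<lambda>t. \<alpha> + \<beta> * (t - c) + \<gamma> * (t - c)\<^sup>2) u = \<alpha> + \<beta> * (u - c) + \<gamma> * (u - c)\<^sup>2"
proof -
  let ?t = "knot n x"
  define bl where "bl v w = \<alpha> + \<beta> * ((v + w) / 2 - c) + \<gamma> * (v - c) * (w - c)" for v w
  have affine: "(1 - r) * bl v w + r * bl v w' = bl v ((1 - r) * w + r * w')" for r v w w'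
    unfolding bl_def by (simp add: field_simps)
  have sym: "bl v w = bl w v" for v w
    by (simp add: bl_def ac_simps)
  have lt: "?t (j - 1) < ?t j"
    by (rule knot_strict_mono[OF part]) (use j in auto)
  have le: "?t (j - 2) \<le> ?t (j - 1)" "?t j \<le> ?t (j + 1)"
    by (auto intro!: knot_mono[OF part])
  have comb: "(1 - (u - p) / (q - p)) * p + (u - p) / (q - p) * q = u" if "p < q" for p q
  proof -
    have lin: "(1 - r) * p + r * q = p + r * (q - p)" for r
      by (simp add: algebra_simps)
    show ?thesis unfolding lin using that by simp
  qed
  have m: "mu n x (j - 1) (\<lambda>t. \<alpha> + \<beta> * (t - c) + \<gamma> * (t - c)\<^sup>2) = bl (?t (j - 1)) (?t (j - 2))"
    "mu n x j (\<lambda>t. \<alpha> + \<beta> * (t - c) + \<gamma> * (t - c)\<^sup>2) = bl (?t (j - 1)) (?t j)"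
    "mu n x (j + 1) (\<lambda>t. \<alpha> + \<beta> * (t - c) + \<gamma> * (t - c)\<^sup>2) = bl (?t j) (?t (j + 1))"
    by (subst mu_quadratic[OF part]; use j in \<open>simp add: bl_def\<close>)+
  let ?w = "\<lambda>p q. (u - p) / (q - p)"
  have left: "(1 - ?w (?t (j - 2)) (?t j)) * bl (?t (j - 1)) (?t (j - 2))
      + ?w (?t (j - 2)) (?t j) * bl (?t (j - 1)) (?t j) = bl u (?t (j - 1))"
    using lt le by (subst affine, subst comb) (auto intro: sym)
  have right: "(1 - ?w (?t (j - 1)) (?t (j + 1))) * bl (?t (j - 1)) (?t j)
      + ?w (?t (j - 1)) (?t (j + 1)) * bl (?t j) (?t (j + 1)) = bl u (?t j)"
    using lt le by (subst sym[of "?t (j - 1)"], subst affine, subst comb) (auto intro: sym)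
  have "quasi_interp n x (\<lambda>t. \<alpha> + \<beta> * (t - c) + \<gamma> * (t - c)\<^sup>2) u = bl u u"
    unfolding quasi_interp_de_boor[OF part j u] m
    unfolding left right
    unfolding affine comb[OF lt] ..
  then show ?thesis by (simp add: bl_def power2_eq_square)
qed

section \<open>Pointwise error for smooth functions\<close>

lemma taylor_quadratic_bound:
  fixes D :: "nat \<Rightarrow> real \<Rightarrow> real"
  assumes D: "\<And>k x. (D k has_real_derivative D (Suc k) x) (at x)"
    and M: "\<And>x. x \<in> {a..b} \<Longrightarrow> \<bar>D 3 x\<bar> \<le> M"
    and t: "t \<in> {a..b}" and c: "c \<in> {a..b}"
  shows "\<bar>D 0 t - (D 0 c + D 1 c * (t - c) + D 2 c / 2 * (t - c)\<^sup>2)\<bar> \<le> M / 6 * \<bar>t - c\<bar> ^ 3"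
proof (cases "t = c")
  case False
  obtain \<xi> where \<xi>: "if t < c then t < \<xi> \<and> \<xi> < c else c < \<xi> \<and> \<xi> < t"
    "D 0 t = (\<Sum>m<3. D m c / fact m * (t - c) ^ m) + D 3 \<xi> / fact 3 * (t - c) ^ 3"
    using Taylor[of 3 D "D 0" a b c t] D t c False by auto
  have "\<xi> \<in> {a..b}" using \<xi>(1) t c by (auto split: if_splits)
  then have "\<bar>D 3 \<xi> / 6 * (t - c) ^ 3\<bar> \<le> M / 6 * \<bar>t - c\<bar> ^ 3"
    using M[of \<xi>] by (simp add: abs_mult power_abs mult_right_mono divide_right_mono)
  moreover have "D 0 t - (D 0 c + D 1 c * (t - c) + D 2 c / 2 * (t - c)\<^sup>2) = D 3 \<xi> / 6 * (t - c) ^ 3"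
    using \<xi>(2) by (simp add: eval_nat_numeral)
  ultimately show ?thesis by (simp only:)
qed simp

text \<open>The intervals are half-open, except that the last one contains \<open>b\<close>, which matches the convention
  for the B-splines of degree zero.\<close>

lemma knot_interval_exists:
  assumes part: "is_partition a b n x" and "a < b" and u: "u \<in> {a..b}"
  obtains j where "1 \<le> j" "j \<le> int n" "knot n x (j - 1) \<le> u" "u < knot n x j \<or> j = int n \<and> u = x n"
proof -
  have ends: "x 0 = a" "x n = b" using part by (auto simp: is_partition_def)
  then have n: "n \<ge> 1" using \<open>a < b\<close> by (cases n) auto
  show ?thesis
  proof (cases "u = b")
    case True
    then show ?thesis
      using that[of "int n"] n ends knot_in_Icc[OF part, of "int n - 1"] by auto
  next
    case False
    define k where "k = (LEAST k. u < x k)"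
    have "u < x n" using False u ends by auto
    then have k: "u < x k" "k \<le> n"
      unfolding k_def by (rule LeastI, intro Least_le)
    then have "k \<noteq> 0" using u ends by (cases k) auto
    then have "x (k - 1) \<le> u"
      using not_less_Least[of "k - 1" "\<lambda>k. u < x k"] unfolding k_def[symmetric] by simp
    then show ?thesis
      using that[of "int k"] k \<open>k \<noteq> 0\<close> by (auto simp: knot_def nat_diff_distrib)
  qed
qed

text \<open>The maximum of \<open>(1 - s) (1 + 9 s)\<close> is \<open>25 / 9\<close>, attained at \<open>s = 4 / 9\<close>; the simpler bound \<open>3\<close> is sharp enough.\<close>

lemma weighted_coef_bound:
  fixes s K w :: real
  assumes "0 \<le> s" "s \<le> 1" "0 \<le> K" "\<bar>w\<bar> \<le> (1 + 9 * s) * K"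
  shows "(1 - s) * \<bar>w\<bar> \<le> 3 * K"
proof -
  have "(1 - s) * \<bar>w\<bar> \<le> (1 - s) * ((1 + 9 * s) * K)"
    using assms by (intro mult_left_mono) auto
  also have "\<dots> = ((1 - s) * (1 + 9 * s)) * K" by simp
  also have "(1 - s) * (1 + 9 * s) \<le> 3"
    using zero_le_power2[of "9 * s - 4"] by (simp add: algebra_simps power2_eq_square)
  finally show ?thesis using assms by (simp add: mult_right_mono)
qed

lemma quasi_interp_add: "quasi_interp n x (\<lambda>t. f t + g t) u = quasi_interp n x f u + quasi_interp n x g u"
  by (simp add: quasi_interp_def mu_add distrib_right sum.distrib)

text \<open>On the interval of \<open>u\<close>, the sampling points of the three active functionals are at distance at most
  \<open>h\<close> or \<open>2 h\<close> from \<open>\<theta>\<^sub>j\<close>, so \<open>g\<close> is at most \<open>K = M h\<^sup>3 / 6\<close> or \<open>8 K\<close> there, and \<open>0\<close> at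
  \<open>\<theta>\<^sub>j\<close> itself. The middle functional is then at most \<open>K\<close>. An outer functional can be as large as
  \<open>(1 + 9 s) K\<close>, but its B-spline carries the complementary factor \<open>1 - s\<close>: a large \<open>s\<close> means that
  the neighbouring interval is long compared with this one, and then the B-spline centred there has not grown much.
  With this gain the three terms of \<open>Q g\<close> and \<open>g(u)\<close> itself add up to at most \<open>3 K + K + K\<close>.\<close>

lemma quasi_interp_cubic_bound:
  assumes part: "is_partition a b n x" and n: "n \<ge> 1" and j: "1 \<le> j" "j \<le> int n"
    and u: "knot n x (j - 1) \<le> u" "u < knot n x j \<or> j = int n \<and> u = x n"
    and g: "\<And>t. t \<in> {a..b} \<Longrightarrow> \<bar>g t\<bar> \<le> M / 6 * \<bar>t - theta n x j\<bar> ^ 3" and "0 \<le> M"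
  shows "\<bar>g u - quasi_interp n x g u\<bar> \<le> 5 / 6 * mesh n x ^ 3 * M"
proof -
  let ?t = "knot n x" and ?c = "theta n x j" and ?h = "mesh n x"
  define K where "K = M / 6 * ?h ^ 3"
  have h: "0 < ?h"
    using step_pos[OF part j] step_le_mesh[OF part n, of j] by simp
  have K: "0 \<le> K" using h \<open>0 \<le> M\<close> by (simp add: K_def)
  have near: "\<bar>g t\<bar> \<le> K" if "t \<in> {a..b}" "\<bar>t - ?c\<bar> \<le> ?h" for t
  proof -
    have "\<bar>g t\<bar> \<le> M / 6 * \<bar>t - ?c\<bar> ^ 3" using g that by blast
    also have "\<dots> \<le> K"
      unfolding K_def using that \<open>0 \<le> M\<close> by (intro mult_left_mono power_mono) auto
    finally show ?thesis .
  qed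
  have far: "\<bar>g t\<bar> \<le> 8 * K" if "t \<in> {a..b}" "\<bar>t - ?c\<bar> \<le> 2 * ?h" for t
  proof -
    have "\<bar>g t\<bar> \<le> M / 6 * \<bar>t - ?c\<bar> ^ 3" using g that by blast
    also have "\<dots> \<le> M / 6 * (2 * ?h) ^ 3"
      using that \<open>0 \<le> M\<close> by (intro mult_left_mono power_mono) auto
    finally show ?thesis by (simp add: K_def power_mult_distrib)
  qed
  have g0: "g ?c = 0" using g[OF theta_in_Icc[OF part], of j] by simp
  have th: "theta n x (j + 1) - ?c = (step n x j + step n x (j + 1)) / 2"
    "theta n x (j + 2) - ?c = (step n x j + 2 * step n x (j + 1) + step n x (j + 2)) / 2"
    "?c - theta n x (j - 1) = (step n x (j - 1) + step n x j) / 2"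
    "?c - theta n x (j - 2) = (step n x (j - 2) + 2 * step n x (j - 1) + step n x j) / 2"
    by (simp_all add: theta_def step_def field_simps)
  have "0 \<le> step n x i" "step n x i \<le> ?h" for i
    using step_nonneg[OF part] step_le_mesh[OF part n] by blast+
  note st = this[of "j - 2"] this[of "j - 1"] this[of j] this[of "j + 1"] this[of "j + 2"]
  have avg: "\<bar>v\<bar> \<le> ?h \<and> \<bar>- v\<bar> \<le> ?h"
    if "v = (p + q) / 2" "0 \<le> p" "p \<le> ?h" "0 \<le> q" "q \<le> ?h" for v p q
    using that by simp
  have avg2: "\<bar>v\<bar> \<le> 2 * ?h"
    if "v = (p + 2 * q + r) / 2" "0 \<le> p" "p \<le> ?h" "0 \<le> q" "q \<le> ?h" "0 \<le> r" "r \<le> ?h" for v p q r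
    using that by simp
  have "\<bar>theta n x (j + 1) - ?c\<bar> \<le> ?h" using avg[OF th(1)] st by blast
  moreover have "\<bar>theta n x (j + 2) - ?c\<bar> \<le> 2 * ?h" using avg2[OF th(2)] st by blast
  moreover have "\<bar>theta n x (j - 1) - ?c\<bar> \<le> ?h" using avg[OF th(3)] st by (simp only: minus_diff_eq)
  moreover have "\<bar>theta n x (j - 2) - ?c\<bar> \<le> 2 * ?h" using avg2[OF th(4)] st by (simp only: abs_minus_commute)
  ultimately have gth: "\<bar>g (theta n x (j + 1))\<bar> \<le> K" "\<bar>g (theta n x (j + 2))\<bar> \<le> 8 * K"
    "\<bar>g (theta n x (j - 1))\<bar> \<le> K" "\<bar>g (theta n x (j - 2))\<bar> \<le> 8 * K"
    by (auto intro!: near far theta_in_Icc[OF part])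
  have tri: "\<bar>A * v1 + B * v2 + C * v3\<bar> \<le> \<bar>A\<bar> * r1 + \<bar>B\<bar> * r2 + \<bar>C\<bar> * r3"
    if "\<bar>v1\<bar> \<le> r1" "\<bar>v2\<bar> \<le> r2" "\<bar>v3\<bar> \<le> r3" for A B C v1 v2 v3 r1 r2 r3 :: real
  proof -
    have "\<bar>A * v1\<bar> \<le> \<bar>A\<bar> * r1" "\<bar>B * v2\<bar> \<le> \<bar>B\<bar> * r2" "\<bar>C * v3\<bar> \<le> \<bar>C\<bar> * r3"
      using that by (auto simp: abs_mult intro: mult_left_mono)
    then show ?thesis by linarith
  qed
  have b01: "0 \<le> sigma n x i" "sigma n x i \<le> 1" "0 \<le> sigma' n x i" "sigma' n x i \<le> 1" for i
    using sigma_bounds[OF part] sigma'_bounds[OF part] by blast+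
  have ss: "0 \<le> sigma n x i * sigma' n x (i + 1)" "sigma n x i * sigma' n x (i + 1) \<le> 1"
    "sigma n x i * sigma' n x (i + 1) \<le> sigma n x i"
    "sigma n x i * sigma' n x (i + 1) \<le> sigma' n x (i + 1)" for i
    using b01 by (auto intro: mult_le_one mult_left_le mult_left_le_one_le)
  have jj: "0 \<le> j" "j \<le> int n + 1" "0 \<le> j + 1" "j + 1 \<le> int n + 1" "0 \<le> j - 1" "j - 1 \<le> int n + 1"
    using j by auto
  have mid: "\<bar>mu n x j g\<bar> \<le> K"
  proof -
    have "\<bar>mu n x j g\<bar> \<le> \<bar>coef_a n x j\<bar> * K + \<bar>coef_b n x j\<bar> * 0 + \<bar>coef_c n x j\<bar> * K"
      unfolding mu_eq[OF jj(1,2)] by (rule tri) (use gth g0 in simp_all)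
    also have "\<dots> = (\<bar>coef_a n x j\<bar> + \<bar>coef_c n x j\<bar>) * K" by (simp add: distrib_right)
    also have "\<dots> \<le> 1 * K"
      unfolding coef_bounds(1)[OF part] by (intro mult_right_mono ss K)
    finally show ?thesis by simp
  qed
  have right: "\<bar>mu n x (j + 1) g\<bar> \<le> (1 + 9 * sigma n x (j + 1)) * K"
  proof -
    let ?b = "sigma n x (j + 1) * sigma' n x (j + 1 + 1)"
    have "\<bar>mu n x (j + 1) g\<bar> \<le> \<bar>coef_a n x (j + 1)\<bar> * 0 + \<bar>coef_b n x (j + 1)\<bar> * K + \<bar>coef_c n x (j + 1)\<bar> * (8 * K)"
      unfolding mu_eq[OF jj(3,4)] by (rule tri) (use gth g0 in \<open>simp_all add: add.commute[of 2 j]\<close>)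
    also have "\<dots> = (1 + ?b + 8 * \<bar>coef_c n x (j + 1)\<bar>) * K"
      using ss(1)[of "j + 1"] by (simp add: coef_bounds(2)[OF part] algebra_simps)
    also have "\<dots> \<le> (1 + 9 * sigma n x (j + 1)) * K"
      using ss(3)[of "j + 1"] coef_bounds(4)[OF part, of "j + 1"] by (intro mult_right_mono K) auto
    finally show ?thesis .
  qed
  have left: "\<bar>mu n x (j - 1) g\<bar> \<le> (1 + 9 * sigma' n x j) * K"
  proof -
    let ?b = "sigma n x (j - 1) * sigma' n x (j - 1 + 1)"
    have "\<bar>mu n x (j - 1) g\<bar> \<le> \<bar>coef_a n x (j - 1)\<bar> * (8 * K) + \<bar>coef_b n x (j - 1)\<bar> * K + \<bar>coef_c n x (j - 1)\<bar> * 0"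
      unfolding mu_eq[OF jj(5,6)] by (rule tri) (use gth g0 in simp_all)
    also have "\<dots> = (1 + ?b + 8 * \<bar>coef_a n x (j - 1)\<bar>) * K"
      using ss(1)[of "j - 1"] by (simp only: coef_bounds(2)[OF part]) (simp add: algebra_simps)
    also have "\<dots> \<le> (1 + 9 * sigma' n x (j - 1 + 1)) * K"
      using ss(4)[of "j - 1"] coef_bounds(3)[OF part, of "j - 1"] by (intro mult_right_mono K) auto
    finally show ?thesis by simp
  qed
  define \<tau> where "\<tau> = (u - ?t (j - 1)) / (?t j - ?t (j - 1))"
  define \<omega> where "\<omega> = (u - ?t (j - 2)) / (?t j - ?t (j - 2))"
  define \<omega>' where "\<omega>' = (u - ?t (j - 1)) / (?t (j + 1) - ?t (j - 1))"
  have lt: "?t (j - 1) < ?t j"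
    by (rule knot_strict_mono[OF part]) (use j in auto)
  have le: "?t (j - 2) \<le> ?t (j - 1)" "?t j \<le> ?t (j + 1)"
    by (rule knot_mono[OF part], simp)+
  have ule: "u \<le> ?t j" using u(2) by (auto simp: knot_def)
  have \<tau>: "0 \<le> \<tau>" "\<tau> \<le> 1"
    using lt u(1) ule by (auto simp: \<tau>_def divide_le_eq_1)
  have \<omega>: "1 - \<omega> = (1 - \<tau>) * sigma n x j"
  proof -
    have "1 - \<omega> = (?t j - u) / (?t j - ?t (j - 2))"
      using lt le by (simp add: \<omega>_def diff_divide_eq_iff)
    moreover have "1 - \<tau> = (?t j - u) / (?t j - ?t (j - 1))"
      using lt by (simp add: \<tau>_def diff_divide_eq_iff)
    moreover have "sigma n x j = (?t j - ?t (j - 1)) / (?t j - ?t (j - 2))"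
      by (simp add: sigma_def step_def)
    ultimately show ?thesis using lt by simp
  qed
  have \<omega>': "\<omega>' = \<tau> * sigma' n x (j + 1)"
  proof -
    have "sigma n x (j + 1) = (?t (j + 1) - ?t j) / (?t (j + 1) - ?t (j - 1))"
      by (simp add: sigma_def step_def)
    then have "sigma' n x (j + 1) = (?t j - ?t (j - 1)) / (?t (j + 1) - ?t (j - 1))"
      using lt le by (simp add: sigma'_def diff_divide_eq_iff)
    then show ?thesis using lt by (simp add: \<tau>_def \<omega>'_def)
  qed
  have \<omega>01: "0 \<le> \<omega>" "\<omega> \<le> 1" "0 \<le> \<omega>'" "\<omega>' \<le> 1"
  proof -
    have "0 \<le> 1 - \<omega>" "1 - \<omega> \<le> 1" "0 \<le> \<omega>'" "\<omega>' \<le> 1"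
      unfolding \<omega> \<omega>' using \<tau> b01 by (auto intro: mult_le_one)
    then show "0 \<le> \<omega>" "\<omega> \<le> 1" "0 \<le> \<omega>'" "\<omega>' \<le> 1" by auto
  qed
  let ?l = "(1 - \<tau>)\<^sup>2 * (sigma n x j * mu n x (j - 1) g)"
  let ?m = "((1 - \<tau>) * \<omega> + \<tau> * (1 - \<omega>')) * mu n x j g"
  let ?r = "\<tau>\<^sup>2 * (sigma' n x (j + 1) * mu n x (j + 1) g)"
  have "quasi_interp n x g u = (1 - \<tau>) * ((1 - \<omega>) * mu n x (j - 1) g + \<omega> * mu n x j g) +
      \<tau> * ((1 - \<omega>') * mu n x j g + \<omega>' * mu n x (j + 1) g)"
    unfolding \<tau>_def \<omega>_def \<omega>'_def by (rule quasi_interp_de_boor[OF part j u])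
  also have "\<dots> = (1 - \<tau>) * (1 - \<omega>) * mu n x (j - 1) g + ?m + \<tau> * \<omega>' * mu n x (j + 1) g"
    by (simp add: algebra_simps)
  also have "\<dots> = ?l + ?m + ?r"
    unfolding \<omega> \<omega>' power2_eq_square by (simp only: mult.assoc)
  finally have Q: "quasi_interp n x g u = ?l + ?m + ?r" .
  have "\<bar>?l\<bar> \<le> (1 - \<tau>)\<^sup>2 * (3 * K)"
    using weighted_coef_bound[of "sigma' n x j" K, OF _ _ K left] b01[of j]
    by (simp add: abs_mult sigma'_def mult_left_mono)
  moreover have "\<bar>?r\<bar> \<le> \<tau>\<^sup>2 * (3 * K)"
    using weighted_coef_bound[of "sigma n x (j + 1)" K, OF _ _ K right] b01[of "j + 1"]
    by (simp add: abs_mult sigma'_def mult_left_mono)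
  moreover have "\<bar>?m\<bar> \<le> K"
  proof -
    have "(1 - \<tau>) * \<omega> \<le> (1 - \<tau>) * 1" "\<tau> * (1 - \<omega>') \<le> \<tau> * 1"
      by (intro mult_left_mono; use \<tau> \<omega>01 in simp)+
    then have "(1 - \<tau>) * \<omega> + \<tau> * (1 - \<omega>') \<le> 1" by simp
    moreover have "0 \<le> (1 - \<tau>) * \<omega> + \<tau> * (1 - \<omega>')"
      using \<tau> \<omega>01 by simp
    ultimately show ?thesis
      using mid by (simp add: abs_mult) (meson abs_ge_zero mult_left_le_one_le order_trans)
  qed
  moreover have "(1 - \<tau>)\<^sup>2 * (3 * K) + \<tau>\<^sup>2 * (3 * K) \<le> 3 * K"
  proof -
    have "(1 - \<tau>)\<^sup>2 + \<tau>\<^sup>2 \<le> 1"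
      using \<tau> mult_left_le[of \<tau> \<tau>] by (simp add: power2_eq_square algebra_simps)
    from mult_right_mono[OF this, of "3 * K"] show ?thesis
      using K by (simp add: distrib_right)
  qed
  moreover have "\<bar>g u\<bar> \<le> K"
  proof (rule near)
    show "u \<in> {a..b}"
      using u(1) ule knot_in_Icc[OF part, of j] knot_in_Icc[OF part, of "j - 1"] by auto
    show "\<bar>u - ?c\<bar> \<le> ?h"
      using u(1) ule st(5,6) lt by (auto simp: theta_def step_def abs_le_iff field_simps)
  qed
  ultimately have "\<bar>g u - quasi_interp n x g u\<bar> \<le> 5 * K"
    unfolding Q by linarith
  then show ?thesis by (simp add: K_def mult.commute)
qed

text \<open>\<open>Q\<close> reproduces the second-order Taylor polynomial at \<open>\<theta>\<^sub>j\<close>, so only the cubic remainder matters.\<close>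

lemma quasi_interp_error_smooth:
  fixes D :: "nat \<Rightarrow> real \<Rightarrow> real"
  assumes part: "is_partition a b n x" and "a < b" and u: "u \<in> {a..b}"
    and D: "\<And>k x. (D k has_real_derivative D (Suc k) x) (at x)"
    and M: "\<And>x. x \<in> {a..b} \<Longrightarrow> \<bar>D 3 x\<bar> \<le> M"
  shows "\<bar>D 0 u - quasi_interp n x (D 0) u\<bar> \<le> 5 / 6 * mesh n x ^ 3 * M"
proof -
  obtain j where j: "1 \<le> j" "j \<le> int n" "knot n x (j - 1) \<le> u" "u < knot n x j \<or> j = int n \<and> u = x n"
    by (rule knot_interval_exists[OF part \<open>a < b\<close> u])
  define c where "c = theta n x j"
  define p where "p t = D 0 c + D 1 c * (t - c) + D 2 c / 2 * (t - c)\<^sup>2" for t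
  define g where "g t = D 0 t - p t" for t
  have c: "c \<in> {a..b}" unfolding c_def by (rule theta_in_Icc[OF part])
  have "D 0 u - quasi_interp n x (D 0) u = D 0 u - quasi_interp n x (\<lambda>t. p t + g t) u"
    by (simp add: g_def)
  also have "quasi_interp n x (\<lambda>t. p t + g t) u = p u + quasi_interp n x g u"
    using quasi_interp_quadratic[OF part j, of "D 0 c" "D 1 c" c "D 2 c / 2"]
    by (simp add: quasi_interp_add p_def)
  also have "D 0 u - (p u + quasi_interp n x g u) = g u - quasi_interp n x g u"
    by (simp add: g_def)
  also have "\<bar>\<dots>\<bar> \<le> 5 / 6 * mesh n x ^ 3 * M"
  proof (rule quasi_interp_cubic_bound[OF part _ j])
    show "n \<ge> 1" using j by auto
    show "\<bar>g t\<bar> \<le> M / 6 * \<bar>t - theta n x j\<bar> ^ 3" if "t \<in> {a..b}" for t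
      using taylor_quadratic_bound[of D a b M t c] D M that c unfolding g_def p_def c_def by blast
    show "0 \<le> M" using M[OF c] by linarith
  qed
  finally show ?thesis .
qed

section \<open>The quadrature error\<close>

lemma bspline_measurable: "bspline t e k j \<in> borel_measurable borel"
proof (induction k arbitrary: j)
  case 0
  show ?case unfolding bspline.simps(1) [abs_def] by measurable
next
  case (Suc k)
  note [measurable] = Suc
  show ?case unfolding bspline.simps(2) [abs_def] by measurable
qed

lemma quasi_interp_measurable: "quasi_interp n x f \<in> borel_measurable borel"
proof -
  note [measurable] = bspline_measurable
  show ?thesis
    unfolding quasi_interp_def [abs_def] qB_def by measurable
qed

lemma quasi_interp_tendsto:
  assumes part: "is_partition a b n x"
    and F: "\<And>t. t \<in> {a..b} \<Longrightarrow> (\<lambda>k. F k t) \<longlonglongrightarrow> f t"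
  shows "(\<lambda>k. quasi_interp n x (F k) u) \<longlonglongrightarrow> quasi_interp n x f u"
proof -
  have "(\<lambda>k. mu n x i (F k)) \<longlonglongrightarrow> mu n x i f" if "i \<in> {0..int n + 1}" for i
    using that unfolding mu_eq[of i n, OF atLeastAtMost_iff[THEN iffD1, THEN conjunct1, OF that] atLeastAtMost_iff[THEN iffD1, THEN conjunct2, OF that]]
    by (intro tendsto_intros F theta_in_Icc[OF part])
  then show ?thesis
    unfolding quasi_interp_def by (intro tendsto_intros) auto
qed

text \<open>For fixed \<open>u\<close> the error is a finite combination of point values of \<open>f\<close>. It is therefore continuous
  under pointwise convergence, and the bound for smooth functions passes to the limit.\<close>

lemma quasi_interp_error:
  assumes part: "is_partition a b n x" and "a < b" and u: "u \<in> {a..b}"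
    and cont: "continuous_on {a..b} f" and f: "f \<in> sobolev_inf 3 a b"
  shows "\<bar>f u - quasi_interp n x f u\<bar> \<le> 5 / 6 * mesh n x ^ 3 * Linf_norm a b (weak_deriv a b 3 f)"
proof -
  let ?M = "Linf_norm a b (weak_deriv a b 3 f)"
  let ?\<kappa> = "5 / 6 * mesh n x ^ 3 * ?M"
  have "\<exists>F. (\<forall>t\<in>{a..b}. \<bar>F t - f t\<bar> \<le> inverse (real (Suc k))) \<and>
      \<bar>F u - quasi_interp n x F u\<bar> \<le> ?\<kappa>" for k
  proof -
    obtain D where D: "\<And>k x. (D k has_real_derivative D (Suc k) x) (at x)"
      "\<And>x. x \<in> {a..b} \<Longrightarrow> \<bar>D 3 x\<bar> \<le> ?M"
      "\<And>x. x \<in> {a..b} \<Longrightarrow> \<bar>D 0 x - f x\<bar> \<le> inverse (real (Suc k))"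
      by (rule smooth_approximation[OF \<open>a < b\<close> cont sobolev_weak_deriv[OF f]]) auto
    have "\<bar>D 0 u - quasi_interp n x (D 0) u\<bar> \<le> ?\<kappa>"
      by (rule quasi_interp_error_smooth[OF part \<open>a < b\<close> u D(1,2)])
    with D(3) show ?thesis by blast
  qed
  then obtain F where F: "\<And>k t. t \<in> {a..b} \<Longrightarrow> \<bar>F k t - f t\<bar> \<le> inverse (real (Suc k))"
    "\<And>k. \<bar>F k u - quasi_interp n x (F k) u\<bar> \<le> ?\<kappa>"
    by metis
  have lim: "(\<lambda>k. F k t) \<longlonglongrightarrow> f t" if "t \<in> {a..b}" for t
  proof (rule Lim_transform2 [OF tendsto_const], rule Lim_null_comparison[OF _ LIMSEQ_inverse_real_of_nat])
    show "\<forall>\<^sub>F k in sequentially. norm (f t - F k t) \<le> inverse (real (Suc k))"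
      using F(1)[OF that] by (simp add: abs_minus_commute)
  qed
  have "(\<lambda>k. \<bar>F k u - quasi_interp n x (F k) u\<bar>) \<longlonglongrightarrow> \<bar>f u - quasi_interp n x f u\<bar>"
    by (intro tendsto_intros lim u quasi_interp_tendsto[OF part])
  then show ?thesis
    by (rule LIMSEQ_le_const2) (use F(2) in blast)
qed

theorem theorem5:
  fixes a b :: real
  assumes "a < b"
  shows "\<exists>C\<^sub>3. 0 < C\<^sub>3 \<and> C\<^sub>3 < b - a \<and>
    (\<forall>f n x. f \<in> sobolev_inf 3 a b \<longrightarrow> continuous_on {a..b} f \<longrightarrow> is_partition a b n x \<longrightarrow>
      \<bar>quad_error a b n x f\<bar> \<le> C\<^sub>3 * mesh n x ^ 3 * Linf_norm a b (weak_deriv a b 3 f))"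
proof (intro exI[of _ "5 / 6 * (b - a)"] conjI allI impI)
  fix f n x
  assume f: "f \<in> sobolev_inf 3 a b" and cont: "continuous_on {a..b} f" and part: "is_partition a b n x"
  let ?Q = "quasi_interp n x f"
  let ?\<kappa> = "5 / 6 * mesh n x ^ 3 * Linf_norm a b (weak_deriv a b 3 f)"
  have err: "norm (f u - ?Q u) \<le> ?\<kappa>" if "u \<in> {a..b}" for u
    using quasi_interp_error[OF part assms that cont f] by simp
  have f_int: "f integrable_on {a..b}"
    by (rule integrable_continuous_interval[OF cont])
  have "?Q \<in> borel_measurable (lebesgue_on {a..b})"
    by (intro measurable_restrict_space1 measurable_completion) (simp add: quasi_interp_measurable)
  then have "(\<lambda>u. f u - ?Q u) \<in> borel_measurable (lebesgue_on {a..b})"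
    using continuous_imp_measurable_on_sets_lebesgue[OF cont] by (intro borel_measurable_diff) auto
  then have d_int: "(\<lambda>u. f u - ?Q u) integrable_on {a..b}"
    by (rule measurable_bounded_by_integrable_imp_integrable[where g = "\<lambda>_. ?\<kappa>"]) (use err in auto)
  \<comment> \<open>The integral of a function that is not integrable would be the default value \<open>0\<close>, so this is needed for the error to be an integral of the difference.\<close>
  have "?Q integrable_on {a..b}"
    using integrable_diff[OF f_int d_int] by simp
  then have "quad_error a b n x f = integral {a..b} (\<lambda>u. f u - ?Q u)"
    unfolding quad_error_def using f_int by (simp add: integral_diff)
  also have "norm \<dots> \<le> integral {a..b} (\<lambda>u. ?\<kappa>)"
    by (rule integral_norm_bound_integral[OF d_int]) (use err in auto)
  also have "\<dots> = (b - a) * ?\<kappa>"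
    using assms by simp
  also have "\<dots> = 5 / 6 * (b - a) * mesh n x ^ 3 * Linf_norm a b (weak_deriv a b 3 f)"
    by (simp only: ac_simps)
  finally show "\<bar>quad_error a b n x f\<bar> \<le> 5 / 6 * (b - a) * mesh n x ^ 3 * Linf_norm a b (weak_deriv a b 3 f)"
    by (simp only: real_norm_def)
qed (use assms in auto)

end
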